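(* Let $(M,\gamma)$ be a Riemannian surface with Gauss curvature $\kappa^*\colon M\to\mathbb{R}$. Then $M$ admits a linear connection $\nabla$ on its tangent bundle that is metric with respect to $\gamma$ (i.e. $\nabla\gamma=0$; torsion is allowed) and has identically zero curvature tensor if and only if there is a smooth vector field $X$ defined on all of $M$ such that $\kappa^*=\operatorname{div}^* X$ on $M$.
   Context: A Riemannian surface is a connected smooth two-dimensional manifold $M$ with a smooth Riemannian metric $\gamma$. $\nabla^*$ denotes the Lévi-Civita connection of $\gamma$, and the divergence of a vector field $X$ is $\operatorname{div}^* X(p)=\gamma(\nabla^*_{e_1}X,e_1)+\gamma(\nabla^*_{e_2}X,e_2)$ for any orthonormal basis $e_1,e_2$ of $T_pM$. The curvature tensor of a linear connection $\nabla$ is $R(X,Y)Z=\nabla_X\nabla_YZ-\nabla_Y\nabla_XZ-\nabla_{[X,Y]}Z$. Replacing $X$ by $-X$, the condition is the same as $\kappa^*=-\operatorname{div}^*X$ for some global smooth vector field $X$. *)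

theory Defs
  imports "HOL-Analysis.Analysis" "HOL-Library.Function_Algebras"
begin

section \<open>Smooth maps on open subsets of Euclidean spaces\<close>

text \<open>For open \<open>S\<close>, \<open>ck_on k f S\<close> says that \<open>f\<close> is \<open>k\<close> times continuously differentiable on \<open>S\<close>.\<close>

fun ck_on :: "nat \<Rightarrow> ('a::euclidean_space \<Rightarrow> 'b::real_normed_vector) \<Rightarrow> 'a set \<Rightarrow> bool" where
  "ck_on 0 f S \<longleftrightarrow> continuous_on S f"
| "ck_on (Suc k) f S \<longleftrightarrow>
     (\<forall>x\<in>S. f differentiable (at x)) \<and>
     (\<forall>v. ck_on k (\<lambda>x. frechet_derivative f (at x) v) S)"

definition smooth_on :: "('a::euclidean_space \<Rightarrow> 'b::real_normed_vector) \<Rightarrow> 'a set \<Rightarrow> bool" where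
  "smooth_on f S \<longleftrightarrow> (\<forall>k. ck_on k f S)"


section \<open>Smooth surfaces\<close>

text \<open>
  The points of the surface are the elements of the type \<open>'a\<close>, which carries the topology.
  A chart is a pair of an open domain and a map to the plane; the values of the map outside the
  domain are irrelevant. The atlas is not required to be maximal.
\<close>

type_synonym 'a chart = "'a set \<times> ('a \<Rightarrow> real^2)"

abbreviation chart_image :: "'a chart \<Rightarrow> (real^2) set" where
  "chart_image c \<equiv> snd c ` fst c"

abbreviation chart_inv :: "'a chart \<Rightarrow> real^2 \<Rightarrow> 'a" where
  "chart_inv c \<equiv> inv_into (fst c) (snd c)"

definition is_chart :: "('a::topological_space) chart \<Rightarrow> bool" where
  "is_chart c \<longleftrightarrow>
     open (fst c) \<and> open (chart_image c) \<and>
     homeomorphism (fst c) (chart_image c) (snd c) (chart_inv c)"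

definition smooth_atlas :: "('a::topological_space) chart set \<Rightarrow> bool" where
  "smooth_atlas A \<longleftrightarrow>
     (\<forall>c\<in>A. is_chart c) \<and>
     (\<Union>c\<in>A. fst c) = UNIV \<and>
     (\<forall>c\<in>A. \<forall>d\<in>A. smooth_on (snd d \<circ> chart_inv c) (snd c ` (fst c \<inter> fst d)))"

definition smooth_surface ::
    "('a::{t2_space, second_countable_topology}) chart set \<Rightarrow> bool" where
  "smooth_surface A \<longleftrightarrow> smooth_atlas A \<and> connected (UNIV :: 'a set)"

definition smooth_fun :: "'a chart set \<Rightarrow> ('a \<Rightarrow> real) \<Rightarrow> bool" where
  "smooth_fun A f \<longleftrightarrow> (\<forall>c\<in>A. smooth_on (f \<circ> chart_inv c) (chart_image c))"


section \<open>Tangent vectors and vector fields\<close>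

text \<open>
  A tangent vector at \<open>p\<close> is the family of its components with respect to all charts around \<open>p\<close>;
  components in different charts are related by the Jacobian of the change of coordinates.
  Components for anything that is not a chart around \<open>p\<close> are \<open>0\<close>, so that tangent vectors are
  equal iff they have the same components. Tangent vectors and vector fields are added pointwise.
\<close>

type_synonym 'a tvec = "'a chart \<Rightarrow> real^2"
type_synonym 'a vfield = "'a \<Rightarrow> 'a tvec"

definition tangent_space :: "'a chart set \<Rightarrow> 'a \<Rightarrow> 'a tvec set" where
  "tangent_space A p =
     {v. (\<forall>c\<in>A. \<forall>d\<in>A. p \<in> fst c \<inter> fst d \<longrightarrow>
            v d = frechet_derivative (snd d \<circ> chart_inv c) (at (snd c p)) (v c)) \<and>
         (\<forall>c. c \<notin> A \<or> p \<notin> fst c \<longrightarrow> v c = 0)}"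

definition tscale :: "real \<Rightarrow> 'a tvec \<Rightarrow> 'a tvec"  (infixr \<open>*\<^sub>T\<close> 75) where
  "a *\<^sub>T v = (\<lambda>c. a *\<^sub>R v c)"

definition vector_fields :: "'a chart set \<Rightarrow> 'a vfield set" where
  "vector_fields A =
     {X. (\<forall>p. X p \<in> tangent_space A p) \<and>
         (\<forall>c\<in>A. smooth_on (\<lambda>x. X (chart_inv c x) c) (chart_image c))}"

text \<open>The derivative \<open>v f\<close>, computed in any chart around \<open>p\<close>.\<close>

definition dir_deriv :: "'a chart set \<Rightarrow> 'a \<Rightarrow> 'a tvec \<Rightarrow> ('a \<Rightarrow> real) \<Rightarrow> real" where
  "dir_deriv A p v f =
     (let c = (SOME c. c \<in> A \<and> p \<in> fst c)
      in frechet_derivative (f \<circ> chart_inv c) (at (snd c p)) (v c))"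

text \<open>In coordinates, \<open>[X, Y] = DY(X) - DX(Y)\<close>.\<close>

definition lie_bracket :: "'a chart set \<Rightarrow> 'a vfield \<Rightarrow> 'a vfield \<Rightarrow> 'a vfield" where
  "lie_bracket A X Y = (\<lambda>p c.
     if c \<in> A \<and> p \<in> fst c
     then frechet_derivative (\<lambda>x. Y (chart_inv c x) c) (at (snd c p)) (X p c)
        - frechet_derivative (\<lambda>x. X (chart_inv c x) c) (at (snd c p)) (Y p c)
     else 0)"


section \<open>Riemannian metrics\<close>

type_synonym 'a metric_tensor = "'a \<Rightarrow> 'a tvec \<Rightarrow> 'a tvec \<Rightarrow> real"

definition riemannian_metric :: "'a chart set \<Rightarrow> 'a metric_tensor \<Rightarrow> bool" where
  "riemannian_metric A \<gamma> \<longleftrightarrow>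
     (\<forall>p. \<forall>u\<in>tangent_space A p. \<forall>v\<in>tangent_space A p. \<forall>w\<in>tangent_space A p. \<forall>a b.
        \<gamma> p (a *\<^sub>T u + b *\<^sub>T v) w = a * \<gamma> p u w + b * \<gamma> p v w) \<and>
     (\<forall>p. \<forall>u\<in>tangent_space A p. \<forall>v\<in>tangent_space A p. \<gamma> p u v = \<gamma> p v u) \<and>
     (\<forall>p. \<forall>v\<in>tangent_space A p. v \<noteq> 0 \<longrightarrow> \<gamma> p v v > 0) \<and>
     (\<forall>X\<in>vector_fields A. \<forall>Y\<in>vector_fields A. smooth_fun A (\<lambda>p. \<gamma> p (X p) (Y p)))"

definition riemannian_surface ::
    "('a::{t2_space, second_countable_topology}) chart set \<Rightarrow> 'a metric_tensor \<Rightarrow> bool" where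
  "riemannian_surface A \<gamma> \<longleftrightarrow> smooth_surface A \<and> riemannian_metric A \<gamma>"

text \<open>As surfaces are two-dimensional, an orthonormal pair is an orthonormal basis.\<close>

definition orthonormal_basis ::
    "'a chart set \<Rightarrow> 'a metric_tensor \<Rightarrow> 'a \<Rightarrow> 'a tvec \<Rightarrow> 'a tvec \<Rightarrow> bool" where
  "orthonormal_basis A \<gamma> p e1 e2 \<longleftrightarrow>
     e1 \<in> tangent_space A p \<and> e2 \<in> tangent_space A p \<and>
     \<gamma> p e1 e1 = 1 \<and> \<gamma> p e2 e2 = 1 \<and> \<gamma> p e1 e2 = 0"

definition some_orthonormal_basis ::
    "'a chart set \<Rightarrow> 'a metric_tensor \<Rightarrow> 'a \<Rightarrow> 'a tvec \<times> 'a tvec" where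
  "some_orthonormal_basis A \<gamma> p = (SOME (e1, e2). orthonormal_basis A \<gamma> p e1 e2)"


section \<open>Linear connections on the tangent bundle\<close>

text \<open>
  A connection sends a smooth vector field \<open>Y\<close> to the smooth section \<open>\<nabla>Y\<close> of the endomorphism
  bundle of the tangent bundle: \<open>D Y p v\<close> is \<open>\<nabla>\<^sub>v Y\<close> for a tangent vector \<open>v\<close> at \<open>p\<close>.
\<close>

type_synonym 'a connection = "'a vfield \<Rightarrow> 'a \<Rightarrow> 'a tvec \<Rightarrow> 'a tvec"

definition cov :: "'a connection \<Rightarrow> 'a vfield \<Rightarrow> 'a vfield \<Rightarrow> 'a vfield" where
  "cov D X Y = (\<lambda>p. D Y p (X p))"

definition linear_connection :: "'a chart set \<Rightarrow> 'a connection \<Rightarrow> bool" where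
  "linear_connection A D \<longleftrightarrow>
     (\<forall>Y\<in>vector_fields A. \<forall>p. \<forall>v\<in>tangent_space A p. D Y p v \<in> tangent_space A p) \<and>
     (\<forall>X\<in>vector_fields A. \<forall>Y\<in>vector_fields A. cov D X Y \<in> vector_fields A) \<and>
     (\<forall>Y\<in>vector_fields A. \<forall>p. \<forall>v\<in>tangent_space A p. \<forall>w\<in>tangent_space A p. \<forall>a b.
        D Y p (a *\<^sub>T v + b *\<^sub>T w) = a *\<^sub>T D Y p v + b *\<^sub>T D Y p w) \<and>
     (\<forall>Y\<in>vector_fields A. \<forall>Z\<in>vector_fields A. \<forall>p. \<forall>v\<in>tangent_space A p.
        D (Y + Z) p v = D Y p v + D Z p v) \<and>
     (\<forall>f Y. smooth_fun A f \<longrightarrow> Y \<in> vector_fields A \<longrightarrow>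
        (\<forall>p. \<forall>v\<in>tangent_space A p.
           D (\<lambda>q. f q *\<^sub>T Y q) p v = dir_deriv A p v f *\<^sub>T Y p + f p *\<^sub>T D Y p v))"

definition metric_connection ::
    "'a chart set \<Rightarrow> 'a metric_tensor \<Rightarrow> 'a connection \<Rightarrow> bool" where
  "metric_connection A \<gamma> D \<longleftrightarrow>
     (\<forall>Y\<in>vector_fields A. \<forall>Z\<in>vector_fields A. \<forall>p. \<forall>v\<in>tangent_space A p.
        dir_deriv A p v (\<lambda>q. \<gamma> q (Y q) (Z q)) = \<gamma> p (D Y p v) (Z p) + \<gamma> p (Y p) (D Z p v))"

definition torsion_free :: "'a chart set \<Rightarrow> 'a connection \<Rightarrow> bool" where
  "torsion_free A D \<longleftrightarrow>
     (\<forall>X\<in>vector_fields A. \<forall>Y\<in>vector_fields A. cov D X Y - cov D Y X = lie_bracket A X Y)"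

definition curvature ::
    "'a chart set \<Rightarrow> 'a connection \<Rightarrow> 'a vfield \<Rightarrow> 'a vfield \<Rightarrow> 'a vfield \<Rightarrow> 'a vfield" where
  "curvature A D X Y Z =
     cov D X (cov D Y Z) - cov D Y (cov D X Z) - cov D (lie_bracket A X Y) Z"

definition flat_connection :: "'a chart set \<Rightarrow> 'a connection \<Rightarrow> bool" where
  "flat_connection A D \<longleftrightarrow>
     (\<forall>X\<in>vector_fields A. \<forall>Y\<in>vector_fields A. \<forall>Z\<in>vector_fields A. curvature A D X Y Z = 0)"

text \<open>
  The value of the curvature tensor on tangent vectors at \<open>p\<close>, by extending them to vector fields;
  by tensoriality the choice of the extensions does not matter.
\<close>

definition curvature_at ::
    "'a chart set \<Rightarrow> 'a connection \<Rightarrow> 'a \<Rightarrow> 'a tvec \<Rightarrow> 'a tvec \<Rightarrow> 'a tvec \<Rightarrow> 'a tvec" where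
  "curvature_at A D p u v w =
     (SOME z. \<exists>X\<in>vector_fields A. \<exists>Y\<in>vector_fields A. \<exists>Z\<in>vector_fields A.
        X p = u \<and> Y p = v \<and> Z p = w \<and> z = curvature A D X Y Z p)"


section \<open>Levi-Civita connection, Gauss curvature, divergence\<close>

text \<open>
  The Levi-Civita connection is unique, but only on smooth vector fields and tangent vectors.
\<close>

definition levi_civita :: "'a chart set \<Rightarrow> 'a metric_tensor \<Rightarrow> 'a connection" where
  "levi_civita A \<gamma> =
     (SOME D. linear_connection A D \<and> metric_connection A \<gamma> D \<and> torsion_free A D)"

text \<open>Neither of the following depends on the choice of the orthonormal basis.\<close>

definition gauss_curvature :: "'a chart set \<Rightarrow> 'a metric_tensor \<Rightarrow> 'a \<Rightarrow> real" where
  "gauss_curvature A \<gamma> p =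
     (let (e1, e2) = some_orthonormal_basis A \<gamma> p
      in \<gamma> p (curvature_at A (levi_civita A \<gamma>) p e1 e2 e2) e1)"

definition divergence :: "'a chart set \<Rightarrow> 'a metric_tensor \<Rightarrow> 'a vfield \<Rightarrow> 'a \<Rightarrow> real" where
  "divergence A \<gamma> X p =
     (let (e1, e2) = some_orthonormal_basis A \<gamma> p
      in \<gamma> p (levi_civita A \<gamma> X p e1) e1 + \<gamma> p (levi_civita A \<gamma> X p e2) e2)"

end

(*
In an orthonormal frame E1, E2 a metric connection D is given by a single connection form w, via
D E1 = w E2 and D E2 = - w E1, and its curvature is the exterior derivative dw. The metric
connections are exactly the D with D_v Y = LC_v Y - <v,Y> V + <V,Y> v, where LC is the Levi-Civita
connection and V an arbitrary vector field. With the area form a, the connection form of D is that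
of LC minus b(v) = a(v,V). On (E1,E2), dw is minus the Gauss curvature for LC, and db is - div V;
so D is flat iff the Gauss curvature is div V. The description of D by V does not refer to an
orientation, hence it is global even though w is not.
*)

theory Submission
  imports Defs "HOL-Real_Asymp.Real_Asymp"
begin

section \<open>Calculus of smooth maps\<close>

text \<open>Connections act on global vector fields only, while orthonormal frames exist only
  locally. So frames are made, with cutoff functions, of global fields that are orthonormal on an
  open set, and identities valid on that set are transferred by locality of derivatives and
  brackets. A metric connection needs no separate locality argument: the metric rule, applied to a
  field and the frame fields, gives its components. Gluing rests on uniqueness at a point instead of
  partitions of unity. Local candidates for the Levi-Civita connection agree at common points, and
  the vector of V at a point is determined by D, so both may be chosen point by point; local
  formulas then give smoothness. One field V describes every metric connection because of dimension
  two: D - LC assigns to v a skew map of the tangent plane, skew maps form a line, and every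
  one-form is v \<mapsto> a(v,V) for exactly one V.\<close>

abbreviation fd :: "('a::real_normed_vector \<Rightarrow> 'b::real_normed_vector) \<Rightarrow> 'a \<Rightarrow> 'a \<Rightarrow> 'b"
  where "fd f x \<equiv> frechet_derivative f (at x)"

lemma fd_eq: "(f has_derivative f') (at x) \<Longrightarrow> fd f x = f'"
  using frechet_derivative_at by metis

text \<open>The two maps have the same candidate derivatives at \<open>x\<close>, so the SOME inside
  \<open>frechet_derivative\<close> chooses the same map, also at points where no derivative
  exists.\<close>

lemma fd_cong:
  assumes "open S" "x \<in> S" "\<And>y. y \<in> S \<Longrightarrow> f y = g y"
  shows "fd f x = fd g x"
proof -
  have "(f has_derivative F) (at x) = (g has_derivative F) (at x)" for F
    using has_derivative_transform_within_open[OF _ assms(1,2)] assms(3) by metis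
  then show ?thesis unfolding frechet_derivative_def by simp
qed

lemma differentiable_cong:
  assumes "open S" "x \<in> S" "\<And>y. y \<in> S \<Longrightarrow> f y = g y"
  shows "f differentiable at x \<longleftrightarrow> g differentiable at x"
  unfolding differentiable_def
  using has_derivative_transform_within_open[OF _ assms(1,2)] assms(3) by metis

lemma fd_chain:
  assumes "g differentiable at x" "f differentiable at (g x)"
  shows "fd (\<lambda>x. f (g x)) x v = fd f (g x) (fd g x v)"
  using frechet_derivative_compose[OF assms] by (simp add: o_def)

lemma fd_linear:
  assumes "f differentiable at x"
  shows "fd f x (a *\<^sub>R u + b *\<^sub>R v) = a *\<^sub>R fd f x u + b *\<^sub>R fd f x v"
  using linear_frechet_derivative[OF assms] by (simp add: linear_add linear_scale)

text \<open>\<open>ck_on\<close> controls derivatives in fixed directions only. The finite basis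
  reduces a direction that varies with the point to fixed ones.\<close>

lemma fd_expand:
  fixes f :: "'a::euclidean_space \<Rightarrow> 'b::real_normed_vector"
  assumes "f differentiable at x"
  shows "fd f x v = (\<Sum>b\<in>Basis. (v \<bullet> b) *\<^sub>R fd f x b)"
proof -
  have "fd f x v = fd f x (\<Sum>b\<in>Basis. (v \<bullet> b) *\<^sub>R b)" by (simp add: euclidean_representation)
  also have "\<dots> = (\<Sum>b\<in>Basis. (v \<bullet> b) *\<^sub>R fd f x b)"
    using linear_frechet_derivative[OF assms] by (simp add: linear_sum linear_scale)
  finally show ?thesis .
qed

lemma ck_on_cong:
  assumes "open S" "\<And>x. x \<in> S \<Longrightarrow> f x = g x"
  shows "ck_on k f S \<longleftrightarrow> ck_on k g S"
  using assms(2)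
proof (induction k arbitrary: f g)
  case 0
  then show ?case by (auto cong: continuous_on_cong)
next
  case (Suc k)
  have "ck_on k (\<lambda>x. fd f x v) S = ck_on k (\<lambda>x. fd g x v) S" for v
    by (rule Suc.IH) (use Suc.prems assms(1) fd_cong in metis)
  moreover have "f differentiable at x \<longleftrightarrow> g differentiable at x" if "x \<in> S" for x
    using differentiable_cong[OF assms(1) that] Suc.prems by blast
  ultimately show ?case by auto
qed

lemma ck_on_imp_continuous: "ck_on k f S \<Longrightarrow> continuous_on S f"
  by (cases k) (auto intro!: continuous_at_imp_continuous_on differentiable_imp_continuous_within)

lemma ck_on_Suc_imp: "ck_on (Suc k) f S \<Longrightarrow> ck_on k f S"
proof (induction k arbitrary: f)
  case 0
  then show ?case using ck_on_imp_continuous by fastforce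
next
  case (Suc k)
  then have "ck_on (Suc k) (\<lambda>x. fd f x v) S" for v
    using ck_on.simps(2) by blast
  then show ?case using Suc ck_on.simps(2) by metis
qed

lemma ck_on_subset: "ck_on k f S \<Longrightarrow> T \<subseteq> S \<Longrightarrow> ck_on k f T"
  by (induction k arbitrary: f) (auto intro: continuous_on_subset)

lemma ck_on_local:
  assumes "\<And>x. x \<in> S \<Longrightarrow> \<exists>T. open T \<and> x \<in> T \<and> ck_on k f T"
  shows "ck_on k f S"
  using assms
proof (induction k arbitrary: f)
  case 0
  then have "isCont f x" if "x \<in> S" for x
    using that by (metis ck_on.simps(1) continuous_on_eq_continuous_at)
  then show ?case using continuous_at_imp_continuous_on ck_on.simps(1) by blast
next
  case (Suc k)
  have "\<exists>T. open T \<and> x \<in> T \<and> ck_on k (\<lambda>x. fd f x v) T" if "x \<in> S" for x v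
    using Suc.prems[OF that] by auto
  then have "ck_on k (\<lambda>x. fd f x v) S" for v
    by (rule Suc.IH)
  moreover have "f differentiable at x" if "x \<in> S" for x
    using Suc.prems[OF that] by auto
  ultimately show ?case by simp
qed

lemma ck_on_const: "ck_on k (\<lambda>x. c) S"
  by (induction k arbitrary: c) auto

lemma ck_on_bounded_linear: "bounded_linear f \<Longrightarrow> ck_on k f S"
proof (cases k)
  case 0
  assume "bounded_linear f"
  then show ?thesis using 0 by (simp add: linear_continuous_on)
next
  case (Suc j)
  assume f: "bounded_linear f"
  then have "(f has_derivative f) (at x)" for x
    by (simp add: bounded_linear_imp_has_derivative)
  then show ?thesis using Suc by (auto simp: fd_eq[of f f] differentiable_def ck_on_const)
qed

lemma ck_on_linear_comp:
  assumes "bounded_linear h" "open S" "ck_on k f S"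
  shows "ck_on k (\<lambda>x. h (f x)) S"
  using assms(3)
proof (induction k arbitrary: f)
  case 0
  then show ?case by (simp add: bounded_linear.continuous_on[OF assms(1)])
next
  case (Suc k)
  have d: "((\<lambda>x. h (f x)) has_derivative (\<lambda>v. h (fd f x v))) (at x)" if "x \<in> S" for x
    using Suc.prems that
    by (auto intro!: bounded_linear.has_derivative[OF assms(1)] simp: frechet_derivative_works[symmetric])
  have "ck_on k (\<lambda>x. fd (\<lambda>x. h (f x)) x v) S" for v
  proof -
    have "ck_on k (\<lambda>x. fd (\<lambda>x. h (f x)) x v) S \<longleftrightarrow> ck_on k (\<lambda>x. h (fd f x v)) S"
      by (rule ck_on_cong[OF assms(2)]) (simp add: fd_eq[OF d])
    then show ?thesis using Suc by simp
  qed
  then show ?case using d by (auto simp: differentiable_def)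
qed

lemma ck_on_add:
  assumes "open S" "ck_on k f S" "ck_on k g S"
  shows "ck_on k (\<lambda>x. f x + g x) S"
  using assms(2,3)
proof (induction k arbitrary: f g)
  case 0
  then show ?case by (simp add: continuous_on_add)
next
  case (Suc k)
  have d: "((\<lambda>x. f x + g x) has_derivative (\<lambda>v. fd f x v + fd g x v)) (at x)" if "x \<in> S" for x
    using Suc.prems that by (auto intro!: has_derivative_add simp: frechet_derivative_works[symmetric])
  have "ck_on k (\<lambda>x. fd (\<lambda>x. f x + g x) x v) S" for v
  proof -
    have "ck_on k (\<lambda>x. fd (\<lambda>x. f x + g x) x v) S \<longleftrightarrow> ck_on k (\<lambda>x. fd f x v + fd g x v) S"
      by (rule ck_on_cong[OF assms(1)]) (simp add: fd_eq[OF d])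
    then show ?thesis using Suc by simp
  qed
  then show ?case using d by (auto simp: differentiable_def)
qed

lemma ck_on_bilinear:
  assumes "bounded_bilinear h" "open S" "ck_on k f S" "ck_on k g S"
  shows "ck_on k (\<lambda>x. h (f x) (g x)) S"
  using assms(3,4)
proof (induction k arbitrary: f g)
  case 0
  then show ?case by (simp add: bounded_bilinear.continuous_on[OF assms(1)])
next
  case (Suc k)
  have d: "((\<lambda>x. h (f x) (g x)) has_derivative (\<lambda>v. h (f x) (fd g x v) + h (fd f x v) (g x))) (at x)"
    if "x \<in> S" for x
    using Suc.prems that
    by (auto intro!: bounded_bilinear.FDERIV[OF assms(1)] simp: frechet_derivative_works[symmetric])
  have "ck_on k (\<lambda>x. fd (\<lambda>x. h (f x) (g x)) x v) S" for v
  proof -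
    have "ck_on k (\<lambda>x. fd (\<lambda>x. h (f x) (g x)) x v) S
        \<longleftrightarrow> ck_on k (\<lambda>x. h (f x) (fd g x v) + h (fd f x v) (g x)) S"
      by (rule ck_on_cong[OF assms(2)]) (simp add: fd_eq[OF d])
    moreover have "ck_on k f S" "ck_on k g S"
      using Suc.prems ck_on_Suc_imp by blast+
    ultimately show ?thesis using Suc by (simp add: ck_on_add assms(2))
  qed
  then show ?case using d by (auto simp: differentiable_def)
qed

lemma ck_on_sum:
  assumes "open S" "\<And>i. i \<in> I \<Longrightarrow> ck_on k (f i) S"
  shows "ck_on k (\<lambda>x. \<Sum>i\<in>I. f i x) S"
  using assms(2)
  by (induction I rule: infinite_finite_induct) (auto simp: ck_on_const ck_on_add assms(1))

lemma ck_on_compose: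
  fixes f :: "'b::euclidean_space \<Rightarrow> 'c::real_normed_vector"
  assumes "open S" "open T" "ck_on k f T" "ck_on k g S" "g ` S \<subseteq> T"
  shows "ck_on k (\<lambda>x. f (g x)) S"
  using assms(3,4)
proof (induction k arbitrary: f)
  case 0
  then show ?case using assms(5) by (auto intro: continuous_on_compose2)
next
  case (Suc k)
  have gd: "g differentiable at x" "f differentiable at (g x)" if "x \<in> S" for x
    using Suc.prems that assms(5) by auto
  then have d: "(\<lambda>x. f (g x)) differentiable at x" if "x \<in> S" for x
    using that differentiable_chain_at[of g x f] by (simp add: o_def)
  have "ck_on k (\<lambda>x. fd (\<lambda>x. f (g x)) x v) S" for v
  proof -
    \<comment> \<open>The direction \<open>fd g x v\<close> in the chain rule varies with
      \<open>x\<close>. After expansion in the basis, the induction hypothesis, general in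
      \<open>f\<close>, applies to the derivatives of \<open>f\<close> in basis directions.\<close>
    have "ck_on k (\<lambda>x. fd (\<lambda>x. f (g x)) x v) S
        \<longleftrightarrow> ck_on k (\<lambda>x. \<Sum>b\<in>Basis. (fd g x v \<bullet> b) *\<^sub>R fd f (g x) b) S"
      by (rule ck_on_cong[OF assms(1)]) (simp add: fd_chain gd fd_expand[OF gd(2)])
    moreover have "ck_on k (\<lambda>x. fd f (g x) b) S" for b
      using Suc.prems ck_on_Suc_imp by (intro Suc.IH) auto
    then have "ck_on k (\<lambda>x. \<Sum>b\<in>Basis. (fd g x v \<bullet> b) *\<^sub>R fd f (g x) b) S"
      using Suc.prems
      by (intro ck_on_sum ck_on_bilinear[OF bounded_bilinear_scaleR]
          ck_on_linear_comp[OF bounded_linear_inner_left] assms(1)) auto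
    ultimately show ?thesis by blast
  qed
  then show ?case unfolding ck_on.simps using d by blast
qed

section \<open>Closure properties of smooth maps\<close>

lemma smooth_on_cong:
  "open S \<Longrightarrow> (\<And>x. x \<in> S \<Longrightarrow> f x = g x) \<Longrightarrow> smooth_on f S \<longleftrightarrow> smooth_on g S"
  unfolding smooth_on_def using ck_on_cong by blast

lemma smooth_on_subset: "smooth_on f S \<Longrightarrow> T \<subseteq> S \<Longrightarrow> smooth_on f T"
  unfolding smooth_on_def using ck_on_subset by blast

lemma smooth_on_local:
  "(\<And>x. x \<in> S \<Longrightarrow> \<exists>T. open T \<and> x \<in> T \<and> smooth_on f T) \<Longrightarrow> smooth_on f S"
  unfolding smooth_on_def using ck_on_local by metis

lemma smooth_on_differentiable: "smooth_on f S \<Longrightarrow> x \<in> S \<Longrightarrow> f differentiable at x"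
  unfolding smooth_on_def by (metis ck_on.simps(2))

lemma smooth_on_continuous: "smooth_on f S \<Longrightarrow> continuous_on S f"
  unfolding smooth_on_def by (metis ck_on.simps(1))

lemma smooth_on_fd: "smooth_on f S \<Longrightarrow> smooth_on (\<lambda>x. fd f x v) S"
  unfolding smooth_on_def by (metis ck_on.simps(2))

lemma smooth_on_const: "smooth_on (\<lambda>x. c) S"
  by (simp add: smooth_on_def ck_on_const)

lemma smooth_on_bounded_linear: "bounded_linear f \<Longrightarrow> smooth_on f S"
  by (simp add: smooth_on_def ck_on_bounded_linear)

lemma smooth_on_ident: "smooth_on (\<lambda>x. x) S"
  by (simp add: smooth_on_bounded_linear)

lemma smooth_on_linear_comp:
  "bounded_linear h \<Longrightarrow> open S \<Longrightarrow> smooth_on f S \<Longrightarrow> smooth_on (\<lambda>x. h (f x)) S"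
  by (simp add: smooth_on_def ck_on_linear_comp)

lemma smooth_on_add:
  "open S \<Longrightarrow> smooth_on f S \<Longrightarrow> smooth_on g S \<Longrightarrow> smooth_on (\<lambda>x. f x + g x) S"
  by (simp add: smooth_on_def ck_on_add)

lemma smooth_on_scaleR:
  "open S \<Longrightarrow> smooth_on f S \<Longrightarrow> smooth_on g S \<Longrightarrow> smooth_on (\<lambda>x. f x *\<^sub>R g x) S"
  by (simp add: smooth_on_def ck_on_bilinear[OF bounded_bilinear_scaleR])

lemma smooth_on_mult:
  fixes f g :: "'a::euclidean_space \<Rightarrow> real"
  shows "open S \<Longrightarrow> smooth_on f S \<Longrightarrow> smooth_on g S \<Longrightarrow> smooth_on (\<lambda>x. f x * g x) S"
  by (simp add: smooth_on_def ck_on_bilinear[OF bounded_bilinear_mult])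

lemma smooth_on_inner:
  fixes f g :: "'a::euclidean_space \<Rightarrow> 'b::real_inner"
  shows "open S \<Longrightarrow> smooth_on f S \<Longrightarrow> smooth_on g S \<Longrightarrow> smooth_on (\<lambda>x. f x \<bullet> g x) S"
  by (simp add: smooth_on_def ck_on_bilinear[OF bounded_bilinear_inner])

lemma smooth_on_minus:
  "open S \<Longrightarrow> smooth_on f S \<Longrightarrow> smooth_on (\<lambda>x. - f x) S"
  by (simp add: smooth_on_linear_comp bounded_linear_minus[OF bounded_linear_ident])

lemma smooth_on_diff:
  "open S \<Longrightarrow> smooth_on f S \<Longrightarrow> smooth_on g S \<Longrightarrow> smooth_on (\<lambda>x. f x - g x) S"
  using smooth_on_add[of S f "\<lambda>x. - g x"] smooth_on_minus[of S g] by simp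

lemma smooth_on_sum:
  "open S \<Longrightarrow> (\<And>i. i \<in> I \<Longrightarrow> smooth_on (f i) S) \<Longrightarrow> smooth_on (\<lambda>x. \<Sum>i\<in>I. f i x) S"
  by (simp add: smooth_on_def ck_on_sum)

lemma smooth_on_compose:
  fixes f :: "'b::euclidean_space \<Rightarrow> 'c::real_normed_vector"
  shows "open S \<Longrightarrow> open T \<Longrightarrow> smooth_on f T \<Longrightarrow> smooth_on g S \<Longrightarrow> g ` S \<subseteq> T
    \<Longrightarrow> smooth_on (\<lambda>x. f (g x)) S"
  unfolding smooth_on_def using ck_on_compose by blast

lemma smooth_on_fd_apply:
  fixes f :: "'a::euclidean_space \<Rightarrow> 'b::real_normed_vector"
  assumes "open S" "smooth_on f S" "smooth_on Y S"
  shows "smooth_on (\<lambda>x. fd f x (Y x)) S"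
proof -
  have "smooth_on (\<lambda>x. \<Sum>b\<in>Basis. (Y x \<bullet> b) *\<^sub>R fd f x b) S"
    using assms by (intro smooth_on_sum smooth_on_scaleR smooth_on_fd
        smooth_on_linear_comp[OF bounded_linear_inner_left])
  moreover have "(\<Sum>b\<in>Basis. (Y x \<bullet> b) *\<^sub>R fd f x b) = fd f x (Y x)" if "x \<in> S" for x
    by (rule fd_expand[OF smooth_on_differentiable[OF assms(2) that], symmetric])
  ultimately show ?thesis
    by (rule smooth_on_cong[OF assms(1), THEN iffD1, rotated])
qed

section \<open>Smooth cutoff functions on the line and on Euclidean spaces\<close>

lemma fd_of_real_derivative:
  "(f has_real_derivative D) (at x) \<Longrightarrow> f differentiable at x \<and> fd f x v = D * v"
  using fd_eq by (fastforce simp: has_field_derivative_def differentiable_def)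

text \<open>The derivative is a multiple of another power, so the induction runs over all exponents.
  The exponents of interest are -1, for quotients, and -1/2, for normalising vectors.\<close>

lemma smooth_on_powr: "smooth_on (\<lambda>x::real. x powr a) {0<..}"
proof -
  have "ck_on k (\<lambda>x::real. x powr a) {0<..}" for k
  proof (induction k arbitrary: a)
    case 0
    then show ?case by (auto intro!: continuous_intros)
  next
    case (Suc k)
    have d: "((\<lambda>x. x powr a) has_real_derivative a * x powr (a - 1)) (at x)" if "x > 0" for x
      using that by (auto intro!: has_real_derivative_powr derivative_eq_intros)
    have "ck_on k (\<lambda>x. fd (\<lambda>x. x powr a) x v) {0<..}" for v
    proof -
      have "ck_on k (\<lambda>x. fd (\<lambda>x. x powr a) x v) {0<..} = ck_on k (\<lambda>x. (a * v) *\<^sub>R x powr (a - 1)) {0<..}"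
        using fd_of_real_derivative[OF d] by (intro ck_on_cong) auto
      then show ?thesis
        using Suc by (simp only: ck_on_linear_comp[OF bounded_linear_scaleR_right] open_greaterThan)
    qed
    then show ?case using fd_of_real_derivative[OF d] by auto
  qed
  then show ?thesis by (simp add: smooth_on_def)
qed

text \<open>The function of interest is \<open>flat_exp 0\<close>, that is exp(-1/t) extended by
  zero. The index makes the family closed under differentiation up to linear combinations, so that
  smoothness follows by induction.\<close>

definition flat_exp :: "nat \<Rightarrow> real \<Rightarrow> real" where
  "flat_exp n t = (if t > 0 then (1 / t) ^ n * exp (- 1 / t) else 0)"

lemma flat_exp_derivative:
  "(flat_exp n has_real_derivative flat_exp (n + 2) t - n * flat_exp (Suc n) t) (at t)"
proof -
  consider "t > 0" | "t < 0" | "t = 0" by linarith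
  then show ?thesis
  proof cases
    case 1
    have "((\<lambda>t. (1 / t) ^ n * exp (- 1 / t)) has_real_derivative
        flat_exp (n + 2) t - n * flat_exp (Suc n) t) (at t)"
    proof -
      have i: "((\<lambda>t. 1 / t) has_real_derivative - ((1 / t) * (1 / t))) (at t)"
        using 1 by (auto intro!: derivative_eq_intros)
      have e: "((\<lambda>t. exp (- 1 / t)) has_real_derivative exp (- 1 / t) * ((1 / t) * (1 / t))) (at t)"
        using 1 by (auto intro!: derivative_eq_intros)
      show ?thesis
        by (rule DERIV_cong[OF DERIV_mult[OF DERIV_power[OF i, of n] e]])
          (use 1 in \<open>cases n; simp add: flat_exp_def algebra_simps power2_eq_square\<close>)
    qed
    then show ?thesis
      by (rule has_field_derivative_transform_within_open[where S="{0<..}"])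
        (use 1 in \<open>auto simp: flat_exp_def\<close>)
  next
    case 2
    have "((\<lambda>t. 0) has_real_derivative 0) (at t)" by simp
    then have "(flat_exp n has_real_derivative 0) (at t)"
      by (rule has_field_derivative_transform_within_open[where S="{..<0}"])
        (use 2 in \<open>auto simp: flat_exp_def\<close>)
    then show ?thesis using 2 by (simp add: flat_exp_def)
  next
    case 3
    \<comment> \<open>Since \<open>flat_exp n 0 = 0\<close>, the difference quotient of
      \<open>flat_exp n\<close> at 0 is \<open>flat_exp (Suc n)\<close>; its limit is the
      derivative.\<close>
    have "((\<lambda>h::real. (1 / h) ^ Suc n * exp (- 1 / h)) \<longlongrightarrow> 0) (at_right 0)"
      by real_asymp
    then have "(flat_exp (Suc n) \<longlongrightarrow> 0) (at_right 0)"
      by (rule Lim_transform_eventually)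
        (auto simp: flat_exp_def eventually_at_filter)
    moreover have "(flat_exp (Suc n) \<longlongrightarrow> 0) (at_left 0)"
      by (rule Lim_transform_eventually[OF tendsto_const])
        (auto simp: flat_exp_def eventually_at_filter)
    ultimately have "(flat_exp (Suc n) \<longlongrightarrow> 0) (at 0)"
      by (simp add: filterlim_at_split)
    then have "((\<lambda>h. (flat_exp n (0 + h) - flat_exp n 0) / h) \<longlongrightarrow> 0) (at 0)"
      by (rule Lim_transform_eventually)
        (auto simp: flat_exp_def eventually_at_filter)
    then have "(flat_exp n has_real_derivative 0) (at 0)"
      by (simp add: DERIV_def)
    then show ?thesis using 3 by (simp add: flat_exp_def)
  qed
qed

lemma smooth_on_flat_exp: "smooth_on (flat_exp n) UNIV"
proof -
  have "ck_on k (flat_exp n) UNIV" for k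
  proof (induction k arbitrary: n)
    case 0
    then show ?case
      using flat_exp_derivative DERIV_isCont by (fastforce intro: continuous_at_imp_continuous_on)
  next
    case (Suc k)
    have "ck_on k (\<lambda>x. fd (flat_exp n) x v) UNIV" for v
    proof -
      have "fd (flat_exp n) x v = v *\<^sub>R flat_exp (n + 2) x + (- n * v) *\<^sub>R flat_exp (Suc n) x" for x
        using fd_of_real_derivative[OF flat_exp_derivative] by (simp add: algebra_simps)
      then show ?thesis
        using Suc
        by (simp only: ck_on_add ck_on_linear_comp[OF bounded_linear_scaleR_right] open_UNIV)
    qed
    then show ?case using fd_of_real_derivative[OF flat_exp_derivative] by auto
  qed
  then show ?thesis by (simp add: smooth_on_def)
qed

text \<open>The witness is h(t) / (h(t) + h(1 - t)) with h = \<open>flat_exp 0\<close>: one of t and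
  1 - t is positive, so the denominator never vanishes. The quotient is written with the exponent -1
  to fit \<open>smooth_on_powr\<close>.\<close>

lemma smooth_step_exists:
  "\<exists>s::real \<Rightarrow> real. smooth_on s UNIV \<and> (\<forall>t. 0 \<le> s t \<and> s t \<le> 1) \<and> (\<forall>t\<le>0. s t = 0) \<and> (\<forall>t\<ge>1. s t = 1)"
proof -
  let ?h = "flat_exp 0"
  let ?d = "\<lambda>t. ?h t + ?h (1 - t)"
  define s where "s = (\<lambda>t. ?h t * ?d t powr (- 1))"
  have pos: "?d t > 0" for t by (auto simp: flat_exp_def add_pos_nonneg)
  have nn: "?h t \<ge> 0" for t by (auto simp: flat_exp_def)
  have "smooth_on (\<lambda>t. ?h (1 - t)) UNIV"
    using smooth_on_compose[OF open_UNIV open_UNIV smooth_on_flat_exp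
        smooth_on_diff[OF open_UNIV smooth_on_const smooth_on_ident]] by auto
  then have "smooth_on ?d UNIV"
    using smooth_on_add[OF open_UNIV smooth_on_flat_exp] by blast
  then have "smooth_on (\<lambda>t. ?d t powr (- 1)) UNIV"
    using smooth_on_compose[OF open_UNIV open_greaterThan smooth_on_powr, of ?d] pos by blast
  then have "smooth_on s UNIV"
    unfolding s_def using smooth_on_mult[OF open_UNIV smooth_on_flat_exp] by blast
  moreover have s: "s t = ?h t / ?d t" for t
    unfolding s_def using pos[of t] by (simp add: powr_minus_divide)
  moreover have "0 \<le> s t \<and> s t \<le> 1" for t
    unfolding s using pos[of t] nn[of t] nn[of "1 - t"] by simp
  moreover have "s t = 0" if "t \<le> 0" for t using that by (simp add: s flat_exp_def)
  moreover have "s t = 1" if "t \<ge> 1" for t using that by (simp add: s flat_exp_def)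
  ultimately show ?thesis by blast
qed

lemma euclidean_bump:
  fixes x :: "'a::euclidean_space"
  assumes "r > 0"
  shows "\<exists>f::'a \<Rightarrow> real. smooth_on f UNIV \<and> (\<forall>y. 0 \<le> f y \<and> f y \<le> 1) \<and>
    (\<forall>y\<in>ball x (r/2). f y = 1) \<and> (\<forall>y. y \<notin> cball x r \<longrightarrow> f y = 0)"
proof -
  obtain s :: "real \<Rightarrow> real" where s: "smooth_on s UNIV" "\<And>t. 0 \<le> s t \<and> s t \<le> 1"
    "\<And>t. t \<le> 0 \<Longrightarrow> s t = 0" "\<And>t. t \<ge> 1 \<Longrightarrow> s t = 1"
    using smooth_step_exists by blast
  \<comment> \<open>Affine in the squared distance, hence smooth at the centre too. The factor is
    chosen so that the value is 0 at distance \<open>r\<close> and 1 at distance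
    \<open>r/2\<close>.\<close>
  let ?t = "\<lambda>y. (4 / (3 * r\<^sup>2)) * (r\<^sup>2 - (y - x) \<bullet> (y - x))"
  have "smooth_on ?t UNIV"
    by (intro smooth_on_mult smooth_on_const smooth_on_diff smooth_on_inner smooth_on_ident open_UNIV)
  then have "smooth_on (\<lambda>y. s (?t y)) UNIV"
    using smooth_on_compose[OF open_UNIV open_UNIV s(1)] by blast
  moreover have "s (?t y) = 1" if "y \<in> ball x (r/2)" for y
  proof -
    have "(norm (y - x))\<^sup>2 \<le> (r/2)\<^sup>2"
      using that assms by (intro power_mono) (auto simp: dist_norm norm_minus_commute)
    then show ?thesis
      using assms by (intro s) (simp add: power2_norm_eq_inner[symmetric] field_simps)
  qed
  moreover have "s (?t y) = 0" if "y \<notin> cball x r" for y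
  proof -
    have "r\<^sup>2 \<le> (norm (y - x))\<^sup>2"
      using that assms by (intro power_mono) (auto simp: dist_norm norm_minus_commute)
    then show ?thesis
      using assms by (intro s) (simp add: power2_norm_eq_inner[symmetric] field_simps)
  qed
  ultimately show ?thesis using s(2) by (intro exI[of _ "\<lambda>y. s (?t y)"]) auto
qed

section \<open>Symmetry of second derivatives and commutators of derivatives along fields\<close>

lemma line_derivative:
  fixes f :: "'a::real_normed_vector \<Rightarrow> real"
  assumes "f differentiable at (x + s *\<^sub>R u)"
  shows "((\<lambda>s. f (x + s *\<^sub>R u)) has_real_derivative fd f (x + s *\<^sub>R u) u) (at s)"
proof -
  have "((\<lambda>s. x + s *\<^sub>R u) has_derivative (\<lambda>h. h *\<^sub>R u)) (at s)"
    by (auto intro!: derivative_eq_intros)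
  moreover have "(f has_derivative fd f (x + s *\<^sub>R u)) (at (x + s *\<^sub>R u))"
    using assms by (simp add: frechet_derivative_works)
  ultimately have "((\<lambda>s. f (x + s *\<^sub>R u)) has_derivative (\<lambda>h. fd f (x + s *\<^sub>R u) (h *\<^sub>R u))) (at s)"
    by (rule has_derivative_compose)
  moreover have "fd f (x + s *\<^sub>R u) (h *\<^sub>R u) = fd f (x + s *\<^sub>R u) u * h" for h
    using linear_frechet_derivative[OF assms] by (simp add: linear_scale)
  ultimately show ?thesis by (simp add: has_field_derivative_def)
qed

text \<open>The mean value theorem is used twice: along \<open>u\<close>, for the difference of
  \<open>f\<close> on two parallel segments, and then along \<open>v\<close>, for the derivative of
  \<open>f\<close> in direction \<open>u\<close>.\<close>

lemma second_difference:
  fixes f :: "'a::euclidean_space \<Rightarrow> real"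
  assumes f: "smooth_on f (ball x r)" and h: "h > 0" "h * (norm u + norm v) < r"
  shows "\<exists>y\<in>ball x r. f (x + h *\<^sub>R u + h *\<^sub>R v) - f (x + h *\<^sub>R u) - (f (x + h *\<^sub>R v) - f x)
    = h * h * fd (\<lambda>z. fd f z u) y v"
proof -
  have inb: "x + a *\<^sub>R u + b *\<^sub>R v \<in> ball x r" if "0 \<le> a" "a \<le> h" "0 \<le> b" "b \<le> h" for a b
  proof -
    have "norm (a *\<^sub>R u + b *\<^sub>R v) \<le> a * norm u + b * norm v"
      using norm_triangle_ineq[of "a *\<^sub>R u" "b *\<^sub>R v"] that by simp
    also have "\<dots> \<le> h * norm u + h * norm v"
      using that by (intro add_mono mult_right_mono) auto
    finally have "norm (a *\<^sub>R u + b *\<^sub>R v) < r"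
      using h by (simp add: algebra_simps)
    then have "norm (x - (x + (a *\<^sub>R u + b *\<^sub>R v))) < r"
      by (metis add_diff_cancel_left' norm_minus_commute)
    then show ?thesis by (simp add: dist_norm add.assoc)
  qed
  have inb0: "x + a *\<^sub>R u \<in> ball x r" if "0 \<le> a" "a \<le> h" for a
    using inb[of a 0] that h(1) by simp
  have "((\<lambda>s. f (x + h *\<^sub>R v + s *\<^sub>R u) - f (x + s *\<^sub>R u)) has_real_derivative
      fd f (x + h *\<^sub>R v + s *\<^sub>R u) u - fd f (x + s *\<^sub>R u) u) (at s)" if "0 \<le> s" "s \<le> h" for s
    using inb[of s h] inb0[of s] that h(1)
    by (intro DERIV_diff line_derivative smooth_on_differentiable[OF f]) (auto simp: ac_simps)
  from MVT2[OF h(1) this] obtain s where s: "0 < s" "s < h"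
    "f (x + h *\<^sub>R v + h *\<^sub>R u) - f (x + h *\<^sub>R u) - (f (x + h *\<^sub>R v) - f x)
      = h * (fd f (x + h *\<^sub>R v + s *\<^sub>R u) u - fd f (x + s *\<^sub>R u) u)"
    by auto
  have "((\<lambda>t. fd f (x + s *\<^sub>R u + t *\<^sub>R v) u) has_real_derivative
      fd (\<lambda>z. fd f z u) (x + s *\<^sub>R u + t *\<^sub>R v) v) (at t)" if "0 \<le> t" "t \<le> h" for t
    using inb[of s t] that s
    by (intro line_derivative[of "\<lambda>z. fd f z u"] smooth_on_differentiable[OF smooth_on_fd[OF f]]) auto
  from MVT2[OF h(1) this] obtain t where t: "0 < t" "t < h"
    "fd f (x + s *\<^sub>R u + h *\<^sub>R v) u - fd f (x + s *\<^sub>R u) u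
      = h * fd (\<lambda>z. fd f z u) (x + s *\<^sub>R u + t *\<^sub>R v) v"
    by auto
  show ?thesis
  proof
    show "x + s *\<^sub>R u + t *\<^sub>R v \<in> ball x r" using inb s t by simp
    show "f (x + h *\<^sub>R u + h *\<^sub>R v) - f (x + h *\<^sub>R u) - (f (x + h *\<^sub>R v) - f x)
        = h * h * fd (\<lambda>z. fd f z u) (x + s *\<^sub>R u + t *\<^sub>R v) v"
      using s t by (simp add: algebra_simps)
  qed
qed

text \<open>The second difference is symmetric in \<open>u\<close> and \<open>v\<close>. By
  \<open>second_difference\<close> the two mixed derivatives take equal values at some points
  arbitrarily near \<open>x\<close>, so by continuity they cannot differ at
  \<open>x\<close>.\<close>

lemma fd_symmetric_real:
  fixes f :: "'a::euclidean_space \<Rightarrow> real"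
  assumes "open S" "smooth_on f S" "x \<in> S"
  shows "fd (\<lambda>y. fd f y u) x v = fd (\<lambda>y. fd f y v) x u"
proof (rule ccontr)
  let ?a = "\<lambda>y. fd (\<lambda>y. fd f y u) y v" and ?b = "\<lambda>y. fd (\<lambda>y. fd f y v) y u"
  assume "?a x \<noteq> ?b x"
  define e where "e = \<bar>?a x - ?b x\<bar> / 2"
  have "e > 0" using \<open>?a x \<noteq> ?b x\<close> by (simp add: e_def)
  have "isCont ?a x" "isCont ?b x"
    using smooth_on_continuous[OF smooth_on_fd[OF smooth_on_fd[OF assms(2)]]] assms(1,3)
      continuous_on_eq_continuous_at by blast+
  then obtain d1 d2 where d: "d1 > 0" "d2 > 0" "\<And>y. dist y x < d1 \<Longrightarrow> \<bar>?a y - ?a x\<bar> < e"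
    "\<And>y. dist y x < d2 \<Longrightarrow> \<bar>?b y - ?b x\<bar> < e"
    using \<open>e > 0\<close> unfolding continuous_at_eps_delta dist_real_def by metis
  obtain d3 where d3: "d3 > 0" "ball x d3 \<subseteq> S"
    using assms(1,3) openE by blast
  define r where "r = min d1 (min d2 d3)"
  have r: "r > 0" "ball x r \<subseteq> S"
    using d d3 by (auto simp: r_def)
  note fr = smooth_on_subset[OF assms(2) r(2)]
  \<comment> \<open>The summand 1 keeps the denominator positive if \<open>u\<close> and
    \<open>v\<close> are zero; the factor 2 makes \<open>h * (norm u + norm v)\<close> strictly less
    than \<open>r\<close>.\<close>
  define h where "h = r / (2 * (norm u + norm v + 1))"
  have hN: "h * (norm u + norm v + 1) = r / 2"
  proof -
    have "norm u + norm v + 1 \<noteq> 0"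
      using norm_ge_zero[of u] norm_ge_zero[of v] by linarith
    then show ?thesis by (simp add: h_def del: distrib_left_numeral)
  qed
  have h: "h > 0" using r by (simp add: h_def add_nonneg_pos)
  have hu: "h * (norm u + norm v) < r" using hN h r by (simp add: algebra_simps)
  obtain y where y: "y \<in> ball x r"
    "f (x + h *\<^sub>R u + h *\<^sub>R v) - f (x + h *\<^sub>R u) - (f (x + h *\<^sub>R v) - f x) = h * h * ?a y"
    using second_difference[OF fr h hu] by blast
  obtain z where z: "z \<in> ball x r"
    "f (x + h *\<^sub>R v + h *\<^sub>R u) - f (x + h *\<^sub>R v) - (f (x + h *\<^sub>R u) - f x) = h * h * ?b z"
    using second_difference[OF fr h, of v u] hu by (auto simp: add.commute)
  have "h * h * ?a y = h * h * ?b z" using y(2) z(2) by (simp add: algebra_simps)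
  then have "?a y = ?b z" using h by simp
  moreover have "\<bar>?a y - ?a x\<bar> < e" "\<bar>?b z - ?b x\<bar> < e"
    using y(1) z(1) d by (auto simp: r_def dist_commute)
  ultimately have "\<bar>?a x - ?b x\<bar> < 2 * e" by linarith
  then show False by (simp add: e_def)
qed

lemma fd_symmetric:
  fixes f :: "'a::euclidean_space \<Rightarrow> 'b::euclidean_space"
  assumes "open S" "smooth_on f S" "x \<in> S"
  shows "fd (\<lambda>y. fd f y u) x v = fd (\<lambda>y. fd f y v) x u"
proof (rule euclidean_eqI)
  fix b :: 'b assume "b \<in> Basis"
  have 1: "fd (\<lambda>y. g y \<bullet> b) z w = fd g z w \<bullet> b" if "smooth_on g S" "z \<in> S" for g :: "'a \<Rightarrow> 'b" and z w
    using bounded_linear.has_derivative[OF bounded_linear_inner_left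
        smooth_on_differentiable[OF that, unfolded frechet_derivative_works]]
    by (rule fd_eq[THEN fun_cong])
  have 2: "fd (\<lambda>y. fd f y u) x v \<bullet> b = fd (\<lambda>y. fd (\<lambda>y. f y \<bullet> b) y u) x v" for u v
  proof -
    have "fd (\<lambda>y. fd f y u \<bullet> b) x = fd (\<lambda>y. fd (\<lambda>y. f y \<bullet> b) y u) x"
      by (rule fd_cong[OF assms(1,3)]) (simp add: 1[OF assms(2)])
    then show ?thesis using 1[OF smooth_on_fd[OF assms(2)] assms(3), of u v] by simp
  qed
  show "fd (\<lambda>y. fd f y u) x v \<bullet> b = fd (\<lambda>y. fd f y v) x u \<bullet> b"
    unfolding 2
    by (rule fd_symmetric_real[OF assms(1) smooth_on_linear_comp[OF bounded_linear_inner_left assms(1,2)] assms(3)])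
qed

text \<open>This is the Leibniz rule after expanding \<open>Y\<close> in the basis. Symmetry of
  second derivatives exchanges \<open>w\<close> with the basis vectors, so that the sum over the
  basis recombines.\<close>

lemma fd_fd_apply:
  fixes f :: "'a::euclidean_space \<Rightarrow> 'b::euclidean_space"
  assumes "open S" "smooth_on f S" "smooth_on Y S" "x \<in> S"
  shows "fd (\<lambda>x. fd f x (Y x)) x w = fd f x (fd Y x w) + fd (\<lambda>y. fd f y w) x (Y x)"
proof -
  note dY = smooth_on_differentiable[OF assms(3,4), unfolded frechet_derivative_works]
  note df = smooth_on_differentiable[OF smooth_on_fd[OF assms(2)] assms(4)]
  have "fd (\<lambda>x. fd f x (Y x)) x = fd (\<lambda>x. \<Sum>b\<in>Basis. (Y x \<bullet> b) *\<^sub>R fd f x b) x"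
    by (rule fd_cong[OF assms(1,4)]) (rule fd_expand[OF smooth_on_differentiable[OF assms(2)]])
  also have "\<dots> = (\<lambda>w. \<Sum>b\<in>Basis. (Y x \<bullet> b) *\<^sub>R fd (\<lambda>y. fd f y b) x w + (fd Y x w \<bullet> b) *\<^sub>R fd f x b)"
    by (intro fd_eq has_derivative_sum bounded_bilinear.FDERIV[OF bounded_bilinear_scaleR]
        bounded_linear.has_derivative[OF bounded_linear_inner_left] dY
        df[unfolded frechet_derivative_works])
  finally have "fd (\<lambda>x. fd f x (Y x)) x w
      = (\<Sum>b\<in>Basis. (Y x \<bullet> b) *\<^sub>R fd (\<lambda>y. fd f y w) x b) + (\<Sum>b\<in>Basis. (fd Y x w \<bullet> b) *\<^sub>R fd f x b)"
    by (simp add: sum.distrib fd_symmetric[OF assms(1,2,4), of _ w])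
  then show ?thesis
    using fd_expand[OF smooth_on_differentiable[OF assms(2,4)], of "fd Y x w"]
      fd_expand[OF df, of w "Y x"] by (simp add: add.commute)
qed

text \<open>The second derivatives of \<open>f\<close> cancel by symmetry. With a transition map as
  \<open>f\<close> this shows that brackets transform like tangent vectors, with a real function
  that the bracket acts as a commutator.\<close>

lemma fd_commutator:
  fixes f :: "'a::euclidean_space \<Rightarrow> 'b::euclidean_space"
  assumes "open S" "smooth_on f S" "smooth_on X S" "smooth_on Y S" "x \<in> S"
  shows "fd (\<lambda>x. fd f x (Y x)) x (X x) - fd (\<lambda>x. fd f x (X x)) x (Y x)
    = fd f x (fd Y x (X x) - fd X x (Y x))"
  unfolding fd_fd_apply[OF assms(1,2,4,5)] fd_fd_apply[OF assms(1,2,3,5)]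
    fd_symmetric[OF assms(1,2,5), of "X x" "Y x"]
  using linear_frechet_derivative[OF smooth_on_differentiable[OF assms(2,5)]]
  by (simp add: linear_diff)

section \<open>Smooth atlases\<close>

locale atlas =
  fixes A :: "('a::t2_space) chart set"
  assumes atlas: "smooth_atlas A"
begin

abbreviation "T \<equiv> tangent_space A"
abbreviation "VF \<equiv> vector_fields A"
abbreviation "dd \<equiv> dir_deriv A"
abbreviation "lie \<equiv> lie_bracket A"
abbreviation tr :: "'a chart \<Rightarrow> 'a chart \<Rightarrow> real^2 \<Rightarrow> real^2"
  where "tr c d \<equiv> snd d \<circ> chart_inv c"

lemma chart_at: obtains c where "c \<in> A" "p \<in> fst c"
  using atlas unfolding smooth_atlas_def by (metis UNIV_I UN_iff)

lemma chart_homeomorphism: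
  "c \<in> A \<Longrightarrow> homeomorphism (fst c) (chart_image c) (snd c) (chart_inv c)"
  using atlas unfolding smooth_atlas_def is_chart_def by blast

lemma open_chart [simp]: "c \<in> A \<Longrightarrow> open (fst c)"
  using atlas unfolding smooth_atlas_def is_chart_def by blast

lemma open_chart_image [simp]: "c \<in> A \<Longrightarrow> open (chart_image c)"
  using atlas unfolding smooth_atlas_def is_chart_def by blast

lemma chart_inv_left [simp]: "c \<in> A \<Longrightarrow> p \<in> fst c \<Longrightarrow> chart_inv c (snd c p) = p"
  using chart_homeomorphism by (simp add: homeomorphism_def)

lemma open_image_chart:
  assumes "c \<in> A" "open U" "U \<subseteq> fst c"
  shows "open (snd c ` U)"
proof -
  have "snd c ` U = chart_image c \<inter> chart_inv c -` U"
    using assms(1,3) by (force simp: image_iff)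
  moreover have "open (chart_image c \<inter> chart_inv c -` U)"
    using chart_homeomorphism[OF assms(1)] assms
    by (intro continuous_open_preimage) (auto simp: homeomorphism_def)
  ultimately show ?thesis by simp
qed

lemma smooth_on_tr:
  assumes "c \<in> A" "d \<in> A" "S \<subseteq> snd c ` (fst c \<inter> fst d)"
  shows "smooth_on (tr c d) S"
  using atlas assms smooth_on_subset unfolding smooth_atlas_def by blast

lemma tr_differentiable:
  assumes "c \<in> A" "d \<in> A" "p \<in> fst c" "p \<in> fst d"
  shows "tr c d differentiable at (snd c p)"
  using smooth_on_differentiable[OF smooth_on_tr[OF assms(1,2) subset_refl]] assms by blast

lemma fd_tr_id:
  assumes "c \<in> A" "p \<in> fst c"
  shows "fd (tr c c) (snd c p) u = u"
proof -
  have "fd (tr c c) (snd c p) = fd (\<lambda>x. x) (snd c p)"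
    by (rule fd_cong[of "chart_image c"]) (use assms in auto)
  then show ?thesis by simp
qed

text \<open>Common source of chart independence: \<open>f\<close> and \<open>g\<close> are the local
  expressions of one object in two charts, be it a third chart map, a function, or the components of
  a vector field.\<close>

lemma fd_tr_chain:
  assumes "c \<in> A" "d \<in> A" "p \<in> fst c" "p \<in> fst d"
    "f differentiable at (snd d p)"
    "open U" "p \<in> U" "\<And>q. q \<in> U \<Longrightarrow> q \<in> fst c \<Longrightarrow> q \<in> fst d \<Longrightarrow> g (snd c q) = f (snd d q)"
  shows "fd g (snd c p) u = fd f (snd d p) (fd (tr c d) (snd c p) u)"
proof -
  have "fd g (snd c p) = fd (\<lambda>x. f (tr c d x)) (snd c p)"
    by (rule fd_cong[of "snd c ` (U \<inter> fst c \<inter> fst d)"])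
      (use assms in \<open>auto intro!: open_image_chart open_Int\<close>)
  then show ?thesis
    using fd_chain[OF tr_differentiable[OF assms(1-4)], of f] assms by simp
qed

lemma fd_tr_tr:
  assumes "c \<in> A" "d \<in> A" "e \<in> A" "p \<in> fst c" "p \<in> fst d" "p \<in> fst e"
  shows "fd (tr c e) (snd c p) u = fd (tr d e) (snd d p) (fd (tr c d) (snd c p) u)"
  by (rule fd_tr_chain[where U=UNIV]) (use assms tr_differentiable in auto)

section \<open>Tangent spaces\<close>

lemma tangentI:
  assumes "\<And>c d. c \<in> A \<Longrightarrow> d \<in> A \<Longrightarrow> p \<in> fst c \<Longrightarrow> p \<in> fst d \<Longrightarrow> v d = fd (tr c d) (snd c p) (v c)"
    "\<And>c. c \<notin> A \<or> p \<notin> fst c \<Longrightarrow> v c = 0"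
  shows "v \<in> T p"
  unfolding tangent_space_def using assms by blast

lemma tangent_change_chart:
  assumes "v \<in> T p" "c \<in> A" "d \<in> A" "p \<in> fst c" "p \<in> fst d"
  shows "v d = fd (tr c d) (snd c p) (v c)"
  using assms unfolding tangent_space_def by blast

lemma tangent_undef: "v \<in> T p \<Longrightarrow> c \<notin> A \<or> p \<notin> fst c \<Longrightarrow> v c = 0"
  unfolding tangent_space_def by blast

text \<open>The Jacobians determine the components in all other charts around \<open>p\<close>, and
  the remaining components are zero. Identities between tangent vectors can thus be checked in the
  plane.\<close>

lemma tangent_eqI:
  assumes "v \<in> T p" "w \<in> T p" "c \<in> A" "p \<in> fst c" "v c = w c"
  shows "v = w"
proof
  fix d show "v d = w d"
    using tangent_change_chart[OF assms(1,3)] tangent_change_chart[OF assms(2,3)] assms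
      tangent_undef[of v p d] tangent_undef[of w p d]
    by metis
qed

lemma tangent_lincomb:
  assumes "u \<in> T p" "v \<in> T p"
  shows "a *\<^sub>T u + b *\<^sub>T v \<in> T p"
proof -
  have "(a *\<^sub>T u + b *\<^sub>T v) d = fd (tr c d) (snd c p) ((a *\<^sub>T u + b *\<^sub>T v) c)"
    if "c \<in> A" "d \<in> A" "p \<in> fst c" "p \<in> fst d" for c d
    using that tangent_change_chart[OF assms(1) that] tangent_change_chart[OF assms(2) that]
    by (simp add: tscale_def fd_linear tr_differentiable)
  moreover have "(a *\<^sub>T u + b *\<^sub>T v) d = 0" if "d \<notin> A \<or> p \<notin> fst d" for d
    using tangent_undef[OF assms(1) that] tangent_undef[OF assms(2) that] by (simp add: tscale_def)
  ultimately show ?thesis by (rule tangentI)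
qed

lemma tscale_simps [simp]: "1 *\<^sub>T u = u" "0 *\<^sub>T u = 0" "a *\<^sub>T 0 = 0" "(- 1) *\<^sub>T u = - u"
  by (auto simp: tscale_def)

lemma T_add: "u \<in> T p \<Longrightarrow> v \<in> T p \<Longrightarrow> u + v \<in> T p"
  using tangent_lincomb[of u p v 1 1] by simp

lemma T_scale: "u \<in> T p \<Longrightarrow> a *\<^sub>T u \<in> T p"
  using tangent_lincomb[of u p u a 0] by simp

lemma T_minus: "u \<in> T p \<Longrightarrow> - u \<in> T p"
  using T_scale[of u p "- 1"] by simp

lemma T_diff: "u \<in> T p \<Longrightarrow> v \<in> T p \<Longrightarrow> u - v \<in> T p"
  using T_add[of u p "- v"] T_minus by simp

text \<open>Inverse to taking the component in \<open>c\<close>; it identifies the plane with the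
  tangent space at a point of \<open>fst c\<close>. The value 0 is the one that
  \<open>tangent_space\<close> prescribes off the charts around \<open>p\<close>.\<close>

definition lift :: "'a chart \<Rightarrow> 'a \<Rightarrow> real^2 \<Rightarrow> 'a tvec" where
  "lift c p u = (\<lambda>d. if d \<in> A \<and> p \<in> fst d then fd (tr c d) (snd c p) u else 0)"

lemma lift_in:
  assumes "c \<in> A" "p \<in> fst c"
  shows "lift c p u \<in> T p"
proof (rule tangentI)
  fix d e assume "d \<in> A" "e \<in> A" "p \<in> fst d" "p \<in> fst e"
  then show "lift c p u e = fd (tr d e) (snd d p) (lift c p u d)"
    unfolding lift_def using fd_tr_tr[OF assms(1) _ _ assms(2), of d e u] by presburger
qed (auto simp: lift_def)

lemma lift_chart: "c \<in> A \<Longrightarrow> p \<in> fst c \<Longrightarrow> lift c p u c = u"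
  by (simp add: lift_def fd_tr_id)

lemma T_zero: "0 \<in> T p"
proof -
  obtain c where "c \<in> A" "p \<in> fst c" by (rule chart_at)
  then show ?thesis using T_scale[OF lift_in, of c p 0] by simp
qed

lemmas T_intros = T_add T_scale T_minus T_diff T_zero

section \<open>Smooth functions and vector fields\<close>

lemma smooth_funI:
  assumes "\<And>p. \<exists>c\<in>A. \<exists>U. open U \<and> p \<in> U \<and> U \<subseteq> fst c \<and> smooth_on (f \<circ> chart_inv c) (snd c ` U)"
  shows "smooth_fun A f"
  unfolding smooth_fun_def
proof (intro ballI smooth_on_local)
  fix d y assume d: "d \<in> A" "y \<in> chart_image d"
  then obtain p where p: "p \<in> fst d" "y = snd d p" by blast
  obtain c U where c: "c \<in> A" "open U" "p \<in> U" "U \<subseteq> fst c" "smooth_on (f \<circ> chart_inv c) (snd c ` U)"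
    using assms by blast
  let ?S = "snd d ` (U \<inter> fst d)"
  have S: "open ?S" using c d by (intro open_image_chart) auto
  have "smooth_on (\<lambda>x. (f \<circ> chart_inv c) (tr d c x)) ?S"
    by (rule smooth_on_compose[OF S open_image_chart[OF c(1,2,4)] c(5) smooth_on_tr])
      (use c d in auto)
  then have "smooth_on (f \<circ> chart_inv d) ?S"
    by (rule smooth_on_cong[OF S, THEN iffD1, rotated]) (use c d in auto)
  then show "\<exists>T. open T \<and> y \<in> T \<and> smooth_on (f \<circ> chart_inv d) T"
    using S c p by blast
qed

lemma smooth_funD: "smooth_fun A f \<Longrightarrow> c \<in> A \<Longrightarrow> S \<subseteq> chart_image c \<Longrightarrow> smooth_on (f \<circ> chart_inv c) S"
  using smooth_on_subset[of "f \<circ> chart_inv c" "chart_image c" S] by (simp add: smooth_fun_def)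

lemma smooth_fun_const: "smooth_fun A (\<lambda>p. a)"
  by (simp add: smooth_fun_def o_def smooth_on_const)

lemma smooth_fun_add: "smooth_fun A f \<Longrightarrow> smooth_fun A g \<Longrightarrow> smooth_fun A (\<lambda>p. f p + g p)"
  by (simp add: smooth_fun_def o_def smooth_on_add)

lemma smooth_fun_diff: "smooth_fun A f \<Longrightarrow> smooth_fun A g \<Longrightarrow> smooth_fun A (\<lambda>p. f p - g p)"
  by (simp add: smooth_fun_def o_def smooth_on_diff)

lemma smooth_fun_minus: "smooth_fun A f \<Longrightarrow> smooth_fun A (\<lambda>p. - f p)"
  by (simp add: smooth_fun_def o_def smooth_on_minus)

lemma smooth_fun_mult: "smooth_fun A f \<Longrightarrow> smooth_fun A g \<Longrightarrow> smooth_fun A (\<lambda>p. f p * g p)"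
  by (simp add: smooth_fun_def o_def smooth_on_mult)

lemma smooth_fun_powr:
  assumes "smooth_fun A f" "\<And>p. f p > 0"
  shows "smooth_fun A (\<lambda>p. f p powr a)"
  unfolding smooth_fun_def
proof
  fix c assume c: "c \<in> A"
  have "smooth_on (\<lambda>x. (f \<circ> chart_inv c) x powr a) (chart_image c)"
    by (rule smooth_on_compose[OF _ open_greaterThan smooth_on_powr[of a]])
      (use assms smooth_funD[OF assms(1) c subset_refl] c in \<open>auto simp: o_def\<close>)
  then show "smooth_on ((\<lambda>p. f p powr a) \<circ> chart_inv c) (chart_image c)"
    by (simp add: o_def)
qed

lemma vector_field_tangent: "X \<in> VF \<Longrightarrow> X p \<in> T p"
  by (simp add: vector_fields_def)

lemma vector_fieldD:
  "X \<in> VF \<Longrightarrow> c \<in> A \<Longrightarrow> S \<subseteq> chart_image c \<Longrightarrow> smooth_on (\<lambda>x. X (chart_inv c x) c) S"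
  using smooth_on_subset[of "\<lambda>x. X (chart_inv c x) c" "chart_image c" S]
  by (simp add: vector_fields_def)

text \<open>The components in \<open>d\<close> are the Jacobian of \<open>tr c d\<close> applied to
  those in \<open>c\<close>, composed with \<open>tr d c\<close>. Both operations preserve
  smoothness, so near each point one chart is enough.\<close>

lemma vector_fieldI:
  assumes X: "\<And>p. X p \<in> T p" and
    loc: "\<And>p. \<exists>c\<in>A. \<exists>U. open U \<and> p \<in> U \<and> U \<subseteq> fst c \<and> smooth_on (\<lambda>x. X (chart_inv c x) c) (snd c ` U)"
  shows "X \<in> VF"
proof -
  have "smooth_on (\<lambda>x. X (chart_inv d x) d) (chart_image d)" if d: "d \<in> A" for d
  proof (rule smooth_on_local)
    fix y assume "y \<in> chart_image d"
    then obtain p where p: "p \<in> fst d" "y = snd d p" by blast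
    obtain c U where c: "c \<in> A" "open U" "p \<in> U" "U \<subseteq> fst c"
      "smooth_on (\<lambda>x. X (chart_inv c x) c) (snd c ` U)"
      using loc by blast
    let ?S = "snd d ` (U \<inter> fst d)" and ?R = "snd c ` (U \<inter> fst d)"
    have S: "open ?S" "open ?R" using c d by (auto intro!: open_image_chart)
    have "smooth_on (\<lambda>x. fd (tr c d) x (X (chart_inv c x) c)) ?R"
      by (rule smooth_on_fd_apply[OF S(2) smooth_on_tr smooth_on_subset[OF c(5)]])
        (use c d in auto)
    then have "smooth_on (\<lambda>x. fd (tr c d) (tr d c x) (X (chart_inv c (tr d c x)) c)) ?S"
      by (rule smooth_on_compose[OF S(1) S(2)])
        (use c d smooth_on_tr[OF d c(1), of "snd d ` (U \<inter> fst d)"] in \<open>auto simp: o_def\<close>)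
    then have "smooth_on (\<lambda>x. X (chart_inv d x) d) ?S"
    proof (rule smooth_on_cong[OF S(1), THEN iffD1, rotated])
      fix x assume "x \<in> ?S"
      then obtain q where q: "q \<in> U" "q \<in> fst d" "q \<in> fst c" "x = snd d q" using c by blast
      show "fd (tr c d) (tr d c x) (X (chart_inv c (tr d c x)) c) = X (chart_inv d x) d"
        using q c d tangent_change_chart[OF X, of c d q] by simp
    qed
    then show "\<exists>T. open T \<and> y \<in> T \<and> smooth_on (\<lambda>x. X (chart_inv d x) d) T"
      using S c p by blast
  qed
  then show ?thesis using X by (simp add: vector_fields_def)
qed

text \<open>Tool for gluing: it yields smoothness of fields that are given by a different formula
  near each point, such as covariant derivatives for the glued connection and the field V.\<close>

lemma vector_field_localI:
  assumes "\<And>p. \<exists>U Y. open U \<and> p \<in> U \<and> Y \<in> VF \<and> (\<forall>q\<in>U. X q = Y q)"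
  shows "X \<in> VF"
proof (rule vector_fieldI)
  fix p
  obtain U Y where U: "open U" "p \<in> U" "Y \<in> VF" "\<forall>q\<in>U. X q = Y q"
    using assms[of p] by (elim exE conjE)
  then show "X p \<in> T p" using vector_field_tangent by metis
  obtain c where c: "c \<in> A" "p \<in> fst c" by (rule chart_at)
  have S: "open (snd c ` (U \<inter> fst c))" using U c by (intro open_image_chart) auto
  have "smooth_on (\<lambda>x. Y (chart_inv c x) c) (snd c ` (U \<inter> fst c))"
    by (rule vector_fieldD[OF U(3) c(1)]) auto
  then have "smooth_on (\<lambda>x. X (chart_inv c x) c) (snd c ` (U \<inter> fst c))"
    by (rule smooth_on_cong[OF S, THEN iffD1, rotated]) (use U c in auto)
  then show "\<exists>c\<in>A. \<exists>U. open U \<and> p \<in> U \<and> U \<subseteq> fst c \<and> smooth_on (\<lambda>x. X (chart_inv c x) c) (snd c ` U)"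
    using U c by (intro bexI[of _ c] exI[of _ "U \<inter> fst c"]) auto
qed

lemma VF_add: "X \<in> VF \<Longrightarrow> Y \<in> VF \<Longrightarrow> (\<lambda>p. X p + Y p) \<in> VF"
  by (simp add: vector_fields_def smooth_on_add T_add)

lemma VF_diff: "X \<in> VF \<Longrightarrow> Y \<in> VF \<Longrightarrow> (\<lambda>p. X p - Y p) \<in> VF"
  by (simp add: vector_fields_def smooth_on_diff T_diff)

lemma VF_scale: "smooth_fun A f \<Longrightarrow> X \<in> VF \<Longrightarrow> (\<lambda>p. f p *\<^sub>T X p) \<in> VF"
  by (simp add: vector_fields_def T_scale) (simp add: tscale_def smooth_fun_def o_def smooth_on_scaleR)

section \<open>Directional derivatives and Lie brackets\<close>

text \<open>By the chain rule the chart picked by SOME in \<open>dir_deriv\<close> is immaterial, so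
  any chart around \<open>p\<close> may be used for computing.\<close>

lemma dir_deriv_chart:
  assumes "c \<in> A" "p \<in> fst c" "v \<in> T p" "smooth_fun A f"
  shows "dd p v f = fd (f \<circ> chart_inv c) (snd c p) (v c)"
proof -
  define d where "d = (SOME c. c \<in> A \<and> p \<in> fst c)"
  have d: "d \<in> A" "p \<in> fst d"
    using someI[of "\<lambda>c. c \<in> A \<and> p \<in> fst c" c] assms by (simp_all add: d_def)
  have df: "(f \<circ> chart_inv c) differentiable at (snd c p)"
    using smooth_on_differentiable[OF smooth_funD[OF assms(4,1) subset_refl]] assms by blast
  have "dd p v f = fd (f \<circ> chart_inv d) (snd d p) (v d)"
    by (simp add: dir_deriv_def d_def Let_def)
  also have "\<dots> = fd (f \<circ> chart_inv c) (snd c p) (fd (tr d c) (snd d p) (v d))"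
    by (rule fd_tr_chain[OF _ _ _ _ df, where U=UNIV]) (use assms d in auto)
  also have "fd (tr d c) (snd d p) (v d) = v c"
    using tangent_change_chart[OF assms(3) d(1) assms(1) d(2) assms(2)] by simp
  finally show ?thesis .
qed

lemma smooth_fun_differentiable:
  "smooth_fun A f \<Longrightarrow> c \<in> A \<Longrightarrow> p \<in> fst c \<Longrightarrow> (f \<circ> chart_inv c) differentiable at (snd c p)"
  using smooth_on_differentiable[OF smooth_funD[OF _ _ subset_refl]] by blast

lemma smooth_fun_has_derivative:
  "smooth_fun A f \<Longrightarrow> c \<in> A \<Longrightarrow> p \<in> fst c
    \<Longrightarrow> (f \<circ> chart_inv c has_derivative fd (f \<circ> chart_inv c) (snd c p)) (at (snd c p))"
  using smooth_fun_differentiable frechet_derivative_works by blast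

lemma dd_lincomb:
  assumes "smooth_fun A f" "u \<in> T p" "v \<in> T p"
  shows "dd p (a *\<^sub>T u + b *\<^sub>T v) f = a * dd p u f + b * dd p v f"
proof -
  obtain c where c: "c \<in> A" "p \<in> fst c" by (rule chart_at)
  show ?thesis
    using assms c fd_linear[OF smooth_fun_differentiable[OF assms(1) c]]
    by (simp add: dir_deriv_chart[OF c] tangent_lincomb) (simp add: tscale_def)
qed

lemma dd_const: "v \<in> T p \<Longrightarrow> dd p v (\<lambda>q. a) = 0"
  by (rule chart_at[of p]) (simp add: dir_deriv_chart smooth_fun_const o_def)

lemma dd_add:
  assumes "smooth_fun A f" "smooth_fun A g" "v \<in> T p"
  shows "dd p v (\<lambda>q. f q + g q) = dd p v f + dd p v g"
proof -
  obtain c where c: "c \<in> A" "p \<in> fst c" by (rule chart_at)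
  have "fd (\<lambda>x. (f \<circ> chart_inv c) x + (g \<circ> chart_inv c) x) (snd c p)
      = (\<lambda>v. fd (f \<circ> chart_inv c) (snd c p) v + fd (g \<circ> chart_inv c) (snd c p) v)"
    using assms c by (intro fd_eq has_derivative_add smooth_fun_has_derivative)
  then show ?thesis
    using assms c by (simp add: dir_deriv_chart[OF c] smooth_fun_add o_def)
qed

lemma dd_mult:
  assumes "smooth_fun A f" "smooth_fun A g" "v \<in> T p"
  shows "dd p v (\<lambda>q. f q * g q) = f p * dd p v g + dd p v f * g p"
proof -
  obtain c where c: "c \<in> A" "p \<in> fst c" by (rule chart_at)
  have "fd (\<lambda>x. (f \<circ> chart_inv c) x * (g \<circ> chart_inv c) x) (snd c p)
      = (\<lambda>v. (f \<circ> chart_inv c) (snd c p) * fd (g \<circ> chart_inv c) (snd c p) v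
          + fd (f \<circ> chart_inv c) (snd c p) v * (g \<circ> chart_inv c) (snd c p))"
    using assms c by (intro fd_eq has_derivative_mult smooth_fun_has_derivative)
  then show ?thesis
    using assms c by (simp add: dir_deriv_chart[OF c] smooth_fun_mult o_def)
qed

lemma dd_minus: "smooth_fun A f \<Longrightarrow> v \<in> T p \<Longrightarrow> dd p v (\<lambda>q. - f q) = - dd p v f"
  using dd_mult[OF smooth_fun_const, of f v p "- 1"] by (simp add: dd_const)

lemma dd_diff:
  "smooth_fun A f \<Longrightarrow> smooth_fun A g \<Longrightarrow> v \<in> T p \<Longrightarrow> dd p v (\<lambda>q. f q - g q) = dd p v f - dd p v g"
  using dd_add[OF _ smooth_fun_minus, of f g v p] by (simp add: dd_minus)

text \<open>Identities in an orthonormal frame hold on an open set only; this permits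
  differentiating them there.\<close>

lemma dd_local:
  assumes "smooth_fun A f" "smooth_fun A g" "v \<in> T p" "open U" "p \<in> U" "\<And>q. q \<in> U \<Longrightarrow> f q = g q"
  shows "dd p v f = dd p v g"
proof -
  obtain c where c: "c \<in> A" "p \<in> fst c" by (rule chart_at)
  have "fd (f \<circ> chart_inv c) (snd c p) = fd (g \<circ> chart_inv c) (snd c p)"
    by (rule fd_cong[of "snd c ` (U \<inter> fst c)"]) (use assms c in \<open>auto intro!: open_image_chart\<close>)
  then show ?thesis using assms c by (simp add: dir_deriv_chart[OF c])
qed

lemma dd_chart:
  assumes "c \<in> A" "x \<in> chart_image c" "X \<in> VF" "smooth_fun A f"
  shows "dd (chart_inv c x) (X (chart_inv c x)) f = fd (f \<circ> chart_inv c) x (X (chart_inv c x) c)"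
  using assms by (auto simp: dir_deriv_chart[OF assms(1)] vector_field_tangent)

lemma smooth_fun_dd:
  assumes "X \<in> VF" "smooth_fun A f"
  shows "smooth_fun A (\<lambda>p. dd p (X p) f)"
  unfolding smooth_fun_def
proof
  fix c assume c: "c \<in> A"
  have "smooth_on (\<lambda>x. fd (f \<circ> chart_inv c) x (X (chart_inv c x) c)) (chart_image c)"
    using c assms by (intro smooth_on_fd_apply smooth_funD vector_fieldD) auto
  then show "smooth_on ((\<lambda>p. dd p (X p) f) \<circ> chart_inv c) (chart_image c)"
    by (rule smooth_on_cong[THEN iffD1, rotated 2]) (use c assms dd_chart in auto)
qed

lemma lie_chart:
  assumes "c \<in> A" "p \<in> fst c"
  shows "lie X Y p c = fd (\<lambda>x. Y (chart_inv c x) c) (snd c p) (X p c)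
      - fd (\<lambda>x. X (chart_inv c x) c) (snd c p) (Y p c)"
  using assms by (simp add: lie_bracket_def)

lemma vector_field_differentiable:
  "X \<in> VF \<Longrightarrow> c \<in> A \<Longrightarrow> p \<in> fst c \<Longrightarrow> (\<lambda>x. X (chart_inv c x) c) differentiable at (snd c p)"
  using smooth_on_differentiable[OF vector_fieldD[OF _ _ subset_refl]] by blast

lemma vector_field_has_derivative:
  "X \<in> VF \<Longrightarrow> c \<in> A \<Longrightarrow> p \<in> fst c
    \<Longrightarrow> ((\<lambda>x. X (chart_inv c x) c) has_derivative fd (\<lambda>x. X (chart_inv c x) c) (snd c p)) (at (snd c p))"
  using vector_field_differentiable frechet_derivative_works by blast

lemma lie_tangent:
  assumes "X \<in> VF" "Y \<in> VF"
  shows "lie X Y p \<in> T p"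
proof -
  have "lie X Y p d = fd (tr c d) (snd c p) (lie X Y p c)"
    if c: "c \<in> A" "p \<in> fst c" and d: "d \<in> A" "p \<in> fst d" for c d
  proof -
    let ?S = "snd c ` (fst c \<inter> fst d)"
    have S: "open ?S" "snd c p \<in> ?S" using c d by (auto intro!: open_image_chart)
    \<comment> \<open>The components of \<open>Z\<close> in \<open>d\<close> are
      \<open>fd (tr c d)\<close> applied to those in \<open>c\<close>. Differentiating them along
      \<open>W\<close> produces the terms of \<open>fd_commutator\<close> for the map
      \<open>tr c d\<close>.\<close>
    have push: "fd (\<lambda>x. Z (chart_inv d x) d) (snd d p) (W p d)
        = fd (\<lambda>x. fd (tr c d) x (Z (chart_inv c x) c)) (snd c p) (W p c)"
      if Z: "Z \<in> VF" and W: "W \<in> VF" for Z W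
    proof -
      have "fd (\<lambda>x. fd (tr c d) x (Z (chart_inv c x) c)) (snd c p) (W p c)
        = fd (\<lambda>x. Z (chart_inv d x) d) (snd d p) (fd (tr c d) (snd c p) (W p c))"
        by (rule fd_tr_chain[OF c(1) d(1) c(2) d(2) vector_field_differentiable[OF Z d], where U=UNIV])
          (use c d Z in \<open>auto intro!: tangent_change_chart[symmetric] vector_field_tangent\<close>)
      then show ?thesis
        using tangent_change_chart[OF vector_field_tangent[OF W] c(1) d(1) c(2) d(2)] by simp
    qed
    show ?thesis
      using fd_commutator[OF S(1) smooth_on_tr[OF c(1) d(1) subset_refl]
          vector_fieldD[OF assms(1) c(1)] vector_fieldD[OF assms(2) c(1)] S(2)] c
      by (auto simp: lie_chart[OF c] lie_chart[OF d] push assms)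
  qed
  moreover have "lie X Y p d = 0" if "d \<notin> A \<or> p \<notin> fst d" for d
    using that by (auto simp: lie_bracket_def)
  ultimately show ?thesis by (intro tangentI)
qed

lemma VF_lie:
  assumes "X \<in> VF" "Y \<in> VF"
  shows "lie X Y \<in> VF"
  unfolding vector_fields_def
proof (intro CollectI conjI allI ballI lie_tangent assms)
  fix c assume c: "c \<in> A"
  have "smooth_on (\<lambda>x. fd (\<lambda>x. Y (chart_inv c x) c) x (X (chart_inv c x) c)
      - fd (\<lambda>x. X (chart_inv c x) c) x (Y (chart_inv c x) c)) (chart_image c)"
    using c assms by (intro smooth_on_diff smooth_on_fd_apply vector_fieldD) auto
  then show "smooth_on (\<lambda>x. lie X Y (chart_inv c x) c) (chart_image c)"
    by (rule smooth_on_cong[THEN iffD1, rotated 2]) (use c in \<open>auto simp: lie_chart\<close>)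
qed

lemma dd_lie:
  assumes "X \<in> VF" "Y \<in> VF" "smooth_fun A f"
  shows "dd p (lie X Y p) f = dd p (X p) (\<lambda>q. dd q (Y q) f) - dd p (Y p) (\<lambda>q. dd q (X q) f)"
proof -
  obtain c where c: "c \<in> A" "p \<in> fst c" by (rule chart_at)
  have push: "dd p (Z p) (\<lambda>q. dd q (W q) f)
      = fd (\<lambda>x. fd (f \<circ> chart_inv c) x (W (chart_inv c x) c)) (snd c p) (Z p c)"
    if "Z \<in> VF" "W \<in> VF" for Z W
  proof -
    have "fd ((\<lambda>q. dd q (W q) f) \<circ> chart_inv c) (snd c p)
        = fd (\<lambda>x. fd (f \<circ> chart_inv c) x (W (chart_inv c x) c)) (snd c p)"
      by (rule fd_cong[of "chart_image c"]) (use c that assms dd_chart in auto)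
    then show ?thesis
      using that c assms by (simp add: dir_deriv_chart[OF c] smooth_fun_dd vector_field_tangent)
  qed
  show ?thesis
    using fd_commutator[OF open_chart_image[OF c(1)] smooth_funD[OF assms(3) c(1)]
        vector_fieldD[OF assms(1) c(1)] vector_fieldD[OF assms(2) c(1)], of "snd c p"] c assms
    by (simp add: push dir_deriv_chart[OF c] lie_tangent lie_chart[OF c])
qed

lemma lie_antisym: "lie X Y p = - lie Y X p"
  by (auto simp: lie_bracket_def)

lemma lie_add_right:
  assumes "X \<in> VF" "Y \<in> VF" "Z \<in> VF"
  shows "lie X (\<lambda>q. Y q + Z q) p = lie X Y p + lie X Z p"
proof (rule chart_at[of p])
  fix c assume c: "c \<in> A" "p \<in> fst c"
  have "fd (\<lambda>x. Y (chart_inv c x) c + Z (chart_inv c x) c) (snd c p)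
      = (\<lambda>v. fd (\<lambda>x. Y (chart_inv c x) c) (snd c p) v + fd (\<lambda>x. Z (chart_inv c x) c) (snd c p) v)"
    using assms c by (intro fd_eq has_derivative_add vector_field_has_derivative)
  moreover have "fd (\<lambda>x. X (chart_inv c x) c) (snd c p) (Y p c + Z p c)
      = fd (\<lambda>x. X (chart_inv c x) c) (snd c p) (Y p c) + fd (\<lambda>x. X (chart_inv c x) c) (snd c p) (Z p c)"
    using linear_frechet_derivative[OF vector_field_differentiable[OF assms(1) c]]
    by (simp add: linear_add)
  ultimately have "lie X (\<lambda>q. Y q + Z q) p c = (lie X Y p + lie X Z p) c"
    by (simp add: lie_chart[OF c])
  then show ?thesis
    using c assms by (intro tangent_eqI[OF _ _ c] lie_tangent VF_add T_add)
qed

lemma lie_scale_right: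
  assumes "X \<in> VF" "Y \<in> VF" "smooth_fun A f"
  shows "lie X (\<lambda>q. f q *\<^sub>T Y q) p = f p *\<^sub>T lie X Y p + dd p (X p) f *\<^sub>T Y p"
proof (rule chart_at[of p])
  fix c assume c: "c \<in> A" "p \<in> fst c"
  have "fd (\<lambda>x. (f \<circ> chart_inv c) x *\<^sub>R Y (chart_inv c x) c) (snd c p)
      = (\<lambda>v. (f \<circ> chart_inv c) (snd c p) *\<^sub>R fd (\<lambda>x. Y (chart_inv c x) c) (snd c p) v
        + fd (f \<circ> chart_inv c) (snd c p) v *\<^sub>R Y (chart_inv c (snd c p)) c)"
    using assms c by (intro fd_eq bounded_bilinear.FDERIV[OF bounded_bilinear_scaleR]
        vector_field_has_derivative smooth_fun_has_derivative)
  moreover have "fd (\<lambda>x. X (chart_inv c x) c) (snd c p) (f p *\<^sub>R Y p c)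
      = f p *\<^sub>R fd (\<lambda>x. X (chart_inv c x) c) (snd c p) (Y p c)"
    using linear_frechet_derivative[OF vector_field_differentiable[OF assms(1) c]]
    by (simp add: linear_scale)
  ultimately have "lie X (\<lambda>q. f q *\<^sub>T Y q) p c = (f p *\<^sub>T lie X Y p + dd p (X p) f *\<^sub>T Y p) c"
    using c assms
    by (simp add: lie_chart[OF c] dir_deriv_chart[OF c] vector_field_tangent tscale_def scaleR_diff_right)
  then show ?thesis
    using c assms by (intro tangent_eqI[OF _ _ c] lie_tangent VF_scale T_add T_scale vector_field_tangent)
qed

lemma lie_local:
  assumes "X \<in> VF" "Y \<in> VF" "X' \<in> VF" "Y' \<in> VF"
    "open U" "p \<in> U" "\<And>q. q \<in> U \<Longrightarrow> X q = X' q" "\<And>q. q \<in> U \<Longrightarrow> Y q = Y' q"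
  shows "lie X Y p = lie X' Y' p"
proof (rule chart_at[of p])
  fix c assume c: "c \<in> A" "p \<in> fst c"
  have S: "open (snd c ` (U \<inter> fst c))" "snd c p \<in> snd c ` (U \<inter> fst c)"
    using assms c by (auto intro!: open_image_chart)
  have "fd (\<lambda>x. X (chart_inv c x) c) (snd c p) = fd (\<lambda>x. X' (chart_inv c x) c) (snd c p)"
    "fd (\<lambda>x. Y (chart_inv c x) c) (snd c p) = fd (\<lambda>x. Y' (chart_inv c x) c) (snd c p)"
    by (rule fd_cong[OF S], use assms c in auto)+
  then have "lie X Y p c = lie X' Y' p c"
    using assms by (simp add: lie_chart[OF c])
  then show ?thesis using assms by (intro tangent_eqI[OF _ _ c] lie_tangent)
qed

section \<open>Cutoff functions\<close>

text \<open>\<open>K\<close> is the image of a compact ball under the inverse chart, hence compact,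
  hence closed in a Hausdorff space. Its complement and the chart domain are then open sets that
  cover the surface, and the extension by zero is smooth on both.\<close>

lemma bump:
  assumes "open W" "p \<in> W"
  shows "\<exists>\<phi> V K. smooth_fun A \<phi> \<and> open V \<and> p \<in> V \<and> V \<subseteq> K \<and> closed K \<and> K \<subseteq> W \<and>
    (\<forall>q. 0 \<le> \<phi> q \<and> \<phi> q \<le> 1) \<and> (\<forall>q\<in>V. \<phi> q = 1) \<and> (\<forall>q. q \<notin> K \<longrightarrow> \<phi> q = 0)"
proof -
  obtain c where c: "c \<in> A" "p \<in> fst c" by (rule chart_at)
  let ?W = "snd c ` (W \<inter> fst c)"
  have "open ?W" "snd c p \<in> ?W" using assms c by (auto intro!: open_image_chart)
  then obtain r where r: "r > 0" "cball (snd c p) r \<subseteq> ?W"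
    using open_contains_cball by blast
  obtain f :: "real^2 \<Rightarrow> real" where f: "smooth_on f UNIV" "\<And>y. 0 \<le> f y \<and> f y \<le> 1"
    "\<And>y. y \<in> ball (snd c p) (r/2) \<Longrightarrow> f y = 1" "\<And>y. y \<notin> cball (snd c p) r \<Longrightarrow> f y = 0"
    using euclidean_bump[OF r(1), of "snd c p"] by blast
  define \<phi> where "\<phi> = (\<lambda>q. if q \<in> fst c then f (snd c q) else 0)"
  define V where "V = fst c \<inter> snd c -` ball (snd c p) (r/2)"
  define K where "K = chart_inv c ` cball (snd c p) r"
  have hom: "continuous_on (fst c) (snd c)" "continuous_on (chart_image c) (chart_inv c)"
    using chart_homeomorphism[OF c(1)] by (auto simp: homeomorphism_def)
  have sub: "cball (snd c p) r \<subseteq> chart_image c" using r by blast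
  have "compact K"
    unfolding K_def using continuous_on_subset[OF hom(2) sub] compact_cball
    by (rule compact_continuous_image)
  then have K: "closed K" by (rule compact_imp_closed)
  have KW: "K \<subseteq> W" "K \<subseteq> fst c" using r c by (force simp: K_def)+
  have phi0: "\<phi> q = 0" if "q \<notin> K" for q
  proof (cases "q \<in> fst c")
    case True
    then have "snd c q \<notin> cball (snd c p) r" using that c by (metis K_def chart_inv_left imageI)
    then show ?thesis using f(4) by (simp add: \<phi>_def)
  qed (simp add: \<phi>_def)
  have V: "open V" unfolding V_def using c hom by (intro continuous_open_preimage) auto
  have "V \<subseteq> K"
  proof
    fix q assume "q \<in> V"
    then have "q \<in> fst c" "snd c q \<in> cball (snd c p) r" using r by (auto simp: V_def)
    then show "q \<in> K" using c by (metis K_def chart_inv_left imageI)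
  qed
  have "smooth_fun A \<phi>"
  proof (rule smooth_funI)
    fix q
    show "\<exists>d\<in>A. \<exists>U. open U \<and> q \<in> U \<and> U \<subseteq> fst d \<and> smooth_on (\<phi> \<circ> chart_inv d) (snd d ` U)"
    proof (cases "q \<in> fst c")
      case True
      have "smooth_on (\<phi> \<circ> chart_inv c) (chart_image c)"
        by (rule smooth_on_cong[THEN iffD1, OF _ _ smooth_on_subset[OF f(1)]])
          (use c in \<open>auto simp: \<phi>_def\<close>)
      then show ?thesis using True c by (intro bexI[of _ c] exI[of _ "fst c"]) auto
    next
      case False
      then have "q \<notin> K" using KW by blast
      obtain d where d: "d \<in> A" "q \<in> fst d" by (rule chart_at)
      have U: "open (fst d \<inter> - K)" using d K by auto
      have "smooth_on (\<phi> \<circ> chart_inv d) (snd d ` (fst d \<inter> - K))"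
        by (rule smooth_on_cong[THEN iffD1, OF _ _ smooth_on_const[of 0]])
          (use d U in \<open>auto simp: phi0 intro!: open_image_chart\<close>)
      then show ?thesis using d U \<open>q \<notin> K\<close> by (intro bexI[of _ d] exI[of _ "fst d \<inter> - K"]) auto
    qed
  qed
  moreover have "p \<in> V" using c r by (simp add: V_def)
  moreover have "\<phi> q = 1" if "q \<in> V" for q using that f(3) by (auto simp: V_def \<phi>_def)
  moreover have "0 \<le> \<phi> q \<and> \<phi> q \<le> 1" for q using f(2) by (auto simp: \<phi>_def)
  ultimately show ?thesis
    using V \<open>V \<subseteq> K\<close> K KW phi0 by (intro exI[of _ \<phi>] exI[of _ V] exI[of _ K]) auto
qed

text \<open>Extension by zero as in \<open>bump\<close>. Where \<open>\<phi>\<close> is 1 the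
  components in \<open>c\<close> are constant; these fields are the raw material for frames and for
  extending tangent vectors.\<close>

lemma cutoff_constant_field:
  assumes "c \<in> A" "smooth_fun A \<phi>" "closed K" "K \<subseteq> fst c" "\<And>q. q \<notin> K \<Longrightarrow> \<phi> q = 0"
  shows "(\<lambda>q. if q \<in> fst c then \<phi> q *\<^sub>T lift c q u else 0) \<in> VF" (is "?X \<in> VF")
proof (rule vector_fieldI)
  fix q
  show "?X q \<in> T q" using assms(1) by (simp add: T_zero T_scale lift_in)
  show "\<exists>d\<in>A. \<exists>U. open U \<and> q \<in> U \<and> U \<subseteq> fst d \<and> smooth_on (\<lambda>x. ?X (chart_inv d x) d) (snd d ` U)"
  proof (cases "q \<in> fst c")
    case True
    have "smooth_on (\<lambda>x. (\<phi> \<circ> chart_inv c) x *\<^sub>R u) (chart_image c)"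
      using assms(1,2) by (intro smooth_on_scaleR smooth_on_const smooth_funD) auto
    then have "smooth_on (\<lambda>x. ?X (chart_inv c x) c) (chart_image c)"
      by (rule smooth_on_cong[THEN iffD1, rotated 2])
        (use assms(1) in \<open>auto simp: tscale_def lift_chart\<close>)
    then show ?thesis using True assms(1) by (intro bexI[of _ c] exI[of _ "fst c"]) auto
  next
    case False
    then have "q \<notin> K" using assms(4) by blast
    obtain d where d: "d \<in> A" "q \<in> fst d" by (rule chart_at)
    have U: "open (fst d \<inter> - K)" using d assms(3) by auto
    have "smooth_on (\<lambda>x. ?X (chart_inv d x) d) (snd d ` (fst d \<inter> - K))"
      by (rule smooth_on_cong[THEN iffD1, OF _ _ smooth_on_const[of 0]])
        (use d U in \<open>auto simp: assms(5) intro!: open_image_chart\<close>)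
    then show ?thesis using d U \<open>q \<notin> K\<close> by (intro bexI[of _ d] exI[of _ "fst d \<inter> - K"]) auto
  qed
qed

lemma vector_field_extension:
  assumes "v \<in> T p"
  shows "\<exists>X\<in>VF. X p = v"
proof -
  obtain c where c: "c \<in> A" "p \<in> fst c" by (rule chart_at)
  obtain \<phi> V K where b: "smooth_fun A \<phi>" "p \<in> V" "closed K" "K \<subseteq> fst c"
    "\<And>q. q \<in> V \<Longrightarrow> \<phi> q = 1" "\<And>q. q \<notin> K \<Longrightarrow> \<phi> q = 0"
    using bump[of "fst c" p] c by auto
  have "lift c p (v c) = v"
    using assms c by (intro tangent_eqI[OF _ _ c] lift_in lift_chart)
  then show ?thesis
    using cutoff_constant_field[OF c(1) b(1,3,4,6), of "v c"] b(2,5) c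
    by (intro bexI[of _ "\<lambda>q. if q \<in> fst c then \<phi> q *\<^sub>T lift c q (v c) else 0"]) auto
qed

end

section \<open>Algebra of the metric\<close>

locale riemannian_atlas = atlas A for A :: "('a::t2_space) chart set" +
  fixes \<gamma> :: "'a metric_tensor"
  assumes metric: "riemannian_metric A \<gamma>"
begin

lemma g_lincomb:
  "u \<in> T p \<Longrightarrow> v \<in> T p \<Longrightarrow> w \<in> T p \<Longrightarrow> \<gamma> p (a *\<^sub>T u + b *\<^sub>T v) w = a * \<gamma> p u w + b * \<gamma> p v w"
  using metric unfolding riemannian_metric_def by blast

lemma g_sym: "u \<in> T p \<Longrightarrow> v \<in> T p \<Longrightarrow> \<gamma> p u v = \<gamma> p v u"
  using metric unfolding riemannian_metric_def by blast

lemma g_pos: "v \<in> T p \<Longrightarrow> v \<noteq> 0 \<Longrightarrow> \<gamma> p v v > 0"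
  using metric unfolding riemannian_metric_def by blast

lemma smooth_fun_g: "X \<in> VF \<Longrightarrow> Y \<in> VF \<Longrightarrow> smooth_fun A (\<lambda>p. \<gamma> p (X p) (Y p))"
  using metric unfolding riemannian_metric_def by blast

lemma g_add_left: "u \<in> T p \<Longrightarrow> v \<in> T p \<Longrightarrow> w \<in> T p \<Longrightarrow> \<gamma> p (u + v) w = \<gamma> p u w + \<gamma> p v w"
  using g_lincomb[of u p v w 1 1] by simp

lemma g_scale_left: "u \<in> T p \<Longrightarrow> w \<in> T p \<Longrightarrow> \<gamma> p (a *\<^sub>T u) w = a * \<gamma> p u w"
  using g_lincomb[of u p u w a 0] by simp

lemma g_minus_left: "u \<in> T p \<Longrightarrow> w \<in> T p \<Longrightarrow> \<gamma> p (- u) w = - \<gamma> p u w"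
  using g_scale_left[of u p w "- 1"] by simp

lemma g_diff_left: "u \<in> T p \<Longrightarrow> v \<in> T p \<Longrightarrow> w \<in> T p \<Longrightarrow> \<gamma> p (u - v) w = \<gamma> p u w - \<gamma> p v w"
  using g_add_left[of u p "- v" w] by (simp add: g_minus_left T_minus)

lemma g_zero_left: "w \<in> T p \<Longrightarrow> \<gamma> p 0 w = 0"
  using g_scale_left[of w p w 0] by simp

lemma g_add_right: "u \<in> T p \<Longrightarrow> v \<in> T p \<Longrightarrow> w \<in> T p \<Longrightarrow> \<gamma> p w (u + v) = \<gamma> p w u + \<gamma> p w v"
  by (simp add: g_sym[of w] T_add g_add_left)

lemma g_scale_right: "u \<in> T p \<Longrightarrow> w \<in> T p \<Longrightarrow> \<gamma> p w (a *\<^sub>T u) = a * \<gamma> p w u"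
  by (simp add: g_sym[of w] T_scale g_scale_left)

lemma g_diff_right: "u \<in> T p \<Longrightarrow> v \<in> T p \<Longrightarrow> w \<in> T p \<Longrightarrow> \<gamma> p w (u - v) = \<gamma> p w u - \<gamma> p w v"
  by (simp add: g_sym[of w] T_diff g_diff_left)

lemmas g_simps = g_add_left g_scale_left g_minus_left g_diff_left g_zero_left
  g_add_right g_scale_right g_diff_right

lemma g_nonneg: "v \<in> T p \<Longrightarrow> \<gamma> p v v \<ge> 0"
  using g_pos[of v p] g_zero_left[of v p] by (cases "v = 0") auto

section \<open>Orthonormal frames\<close>

text \<open>Orthonormality is asked on \<open>U\<close> only, since a surface need not carry a
  global orthonormal frame; the fields are global because connections take global fields as
  arguments.\<close>

definition frame :: "'a vfield \<Rightarrow> 'a vfield \<Rightarrow> 'a set \<Rightarrow> bool" where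
  "frame E1 E2 U \<longleftrightarrow> E1 \<in> VF \<and> E2 \<in> VF \<and> open U \<and>
     (\<forall>p\<in>U. \<gamma> p (E1 p) (E1 p) = 1 \<and> \<gamma> p (E2 p) (E2 p) = 1 \<and> \<gamma> p (E1 p) (E2 p) = 0)"

text \<open>Gram-Schmidt for the extensions of \<open>u1\<close> and \<open>u2\<close> whose
  components in a chart are \<open>\<phi>\<close> times constants. It changes nothing at
  \<open>p\<close> if the pair is already orthonormal there, so a frame can pass through a
  prescribed basis.\<close>

lemma frame_extension:
  assumes u: "u1 \<in> T p" "u2 \<in> T p" and indep: "\<And>a b. a *\<^sub>T u1 + b *\<^sub>T u2 = 0 \<Longrightarrow> a = 0 \<and> b = 0"
  shows "\<exists>E1 E2 U. frame E1 E2 U \<and> p \<in> U \<and>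
    (orthonormal_basis A \<gamma> p u1 u2 \<longrightarrow> E1 p = u1 \<and> E2 p = u2)"
proof -
  obtain c where c: "c \<in> A" "p \<in> fst c" by (rule chart_at)
  obtain \<phi> V K where b: "smooth_fun A \<phi>" "open V" "p \<in> V" "V \<subseteq> K" "closed K" "K \<subseteq> fst c"
    "\<And>q. 0 \<le> \<phi> q \<and> \<phi> q \<le> 1" "\<And>q. q \<in> V \<Longrightarrow> \<phi> q = 1" "\<And>q. q \<notin> K \<Longrightarrow> \<phi> q = 0"
    using bump[of "fst c" p] c by auto
  define F where "F = (\<lambda>u q. if q \<in> fst c then \<phi> q *\<^sub>T lift c q (u c) else (0 :: 'a tvec))"
  have F: "F u \<in> VF" for u
    unfolding F_def using cutoff_constant_field[OF c(1) b(1,5,6,9)] by blast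
  have Fc: "F u q c = \<phi> q *\<^sub>R u c" if "q \<in> fst c" for u q
    using that c by (simp add: F_def tscale_def lift_chart)
  have Fp: "F u p = u" if "u \<in> T p" for u
    by (rule tangent_eqI[OF vector_field_tangent[OF F] that c]) (simp add: Fc c b)
  have indc: "a = 0 \<and> b = 0" if "a *\<^sub>R u1 c + b *\<^sub>R u2 c = 0" for a b
    using that c u by (intro indep tangent_eqI[OF _ T_zero c] tangent_lincomb) (auto simp: tscale_def)
  \<comment> \<open>The summand \<open>1 - \<phi> q\<close> keeps this positive where the field
    vanishes, so that the power -1/2 is smooth everywhere. It is 0 on \<open>V\<close>, where the
    normalisation must be exact.\<close>
  define N1 where "N1 = (\<lambda>q. \<gamma> q (F u1 q) (F u1 q) + (1 - \<phi> q))"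
  have N1: "N1 q > 0" for q
  proof (cases "\<phi> q = 0")
    case True
    then show ?thesis using g_nonneg[OF vector_field_tangent[OF F]] by (simp add: N1_def add_nonneg_pos)
  next
    case False
    then have "q \<in> fst c" using b by blast
    then have "F u1 q c \<noteq> 0" using Fc indc[of 1 0] False by auto
    then have "F u1 q \<noteq> 0" by (metis zero_fun_apply)
    then show ?thesis
      using g_pos[OF vector_field_tangent[OF F]] b(7)[of q] by (simp add: N1_def add_pos_nonneg)
  qed
  define E1 where "E1 = (\<lambda>q. N1 q powr (- 1 / 2) *\<^sub>T F u1 q)"
  have "smooth_fun A N1"
    unfolding N1_def by (intro smooth_fun_add smooth_fun_diff smooth_fun_g smooth_fun_const F b(1))
  then have E1: "E1 \<in> VF"
    unfolding E1_def by (intro VF_scale smooth_fun_powr F N1)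
  define G where "G = (\<lambda>q. F u2 q - \<gamma> q (F u2 q) (E1 q) *\<^sub>T E1 q)"
  have G: "G \<in> VF" unfolding G_def by (intro VF_diff VF_scale smooth_fun_g F E1)
  define N2 where "N2 = (\<lambda>q. \<gamma> q (G q) (G q) + (1 - \<phi> q))"
  have N2: "N2 q > 0" for q
  proof (cases "\<phi> q = 0")
    case True
    then show ?thesis using g_nonneg[OF vector_field_tangent[OF G]] by (simp add: N2_def add_nonneg_pos)
  next
    case False
    then have q: "q \<in> fst c" using b by blast
    \<comment> \<open>In the chart, \<open>G q\<close> is a combination of \<open>u1 c\<close> and
      \<open>u2 c\<close> whose coefficient at \<open>u2 c\<close> is \<open>\<phi> q\<close>, which
      is not zero in this case.\<close>
    have "G q c \<noteq> 0"
    proof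
      assume "G q c = 0"
      then have "(- (\<gamma> q (F u2 q) (E1 q) * N1 q powr (- 1 / 2) * \<phi> q)) *\<^sub>R u1 c + \<phi> q *\<^sub>R u2 c = 0"
        by (simp add: G_def E1_def tscale_def Fc[OF q])
      then show False using indc False by blast
    qed
    then have "G q \<noteq> 0" by (metis zero_fun_apply)
    then show ?thesis
      using g_pos[OF vector_field_tangent[OF G]] b(7)[of q] by (simp add: N2_def add_pos_nonneg)
  qed
  define E2 where "E2 = (\<lambda>q. N2 q powr (- 1 / 2) *\<^sub>T G q)"
  have "smooth_fun A N2"
    unfolding N2_def by (intro smooth_fun_add smooth_fun_diff smooth_fun_g smooth_fun_const G b(1))
  then have E2: "E2 \<in> VF"
    unfolding E2_def by (intro VF_scale smooth_fun_powr G N2)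
  note t = vector_field_tangent[OF F] vector_field_tangent[OF G] vector_field_tangent[OF E1]
  have half: "x powr (- 1 / 2) * (x powr (- 1 / 2) * x) = 1" if "x > 0" for x :: real
  proof -
    have "x powr (- 1 / 2) * (x powr (- 1 / 2) * x) = x powr (- 1 / 2) * (x powr (- 1 / 2) * x powr 1)"
      using that by simp
    also have "\<dots> = 1" using that by (simp only: powr_add[symmetric]) simp
    finally show ?thesis .
  qed
  have e11: "\<gamma> q (E1 q) (E1 q) = 1" if "q \<in> V" for q
    using half[OF N1[of q]] b(8)[OF that] by (simp add: E1_def g_simps t T_intros N1_def)
  have e22: "\<gamma> q (E2 q) (E2 q) = 1" if "q \<in> V" for q
    using half[OF N2[of q]] b(8)[OF that] by (simp add: E2_def g_simps t T_intros N2_def)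
  have e12: "\<gamma> q (E1 q) (E2 q) = 0" if "q \<in> V" for q
    using e11[OF that] g_sym[OF t(1)[of u2 q] t(3)[of q]] by (simp add: E2_def G_def g_simps t T_intros)
  have "frame E1 E2 V"
    using E1 E2 b(2) e11 e22 e12 by (simp add: frame_def)
  moreover have "E1 p = u1 \<and> E2 p = u2" if o: "orthonormal_basis A \<gamma> p u1 u2"
  proof -
    have "E1 p = u1" using o b by (simp add: E1_def N1_def Fp u orthonormal_basis_def)
    moreover have "G p = u2"
      using o calculation g_sym[OF u] by (simp add: G_def Fp u orthonormal_basis_def)
    then have "E2 p = u2" using o b by (simp add: E2_def N2_def orthonormal_basis_def)
    ultimately show ?thesis by blast
  qed
  ultimately show ?thesis using b(3) by blast
qed

lemma frame_of_orthonormal_basis: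
  assumes o: "orthonormal_basis A \<gamma> p e1 e2"
  shows "\<exists>E1 E2 U. frame E1 E2 U \<and> p \<in> U \<and> E1 p = e1 \<and> E2 p = e2"
proof -
  have e: "e1 \<in> T p" "e2 \<in> T p" "\<gamma> p e1 e1 = 1" "\<gamma> p e2 e2 = 1" "\<gamma> p e1 e2 = 0"
    using o by (auto simp: orthonormal_basis_def)
  have "a = 0 \<and> b = 0" if z: "a *\<^sub>T e1 + b *\<^sub>T e2 = 0" for a b
    using g_lincomb[OF e(1,2) e(1), of a b] g_lincomb[OF e(1,2) e(2), of a b] e g_sym[OF e(1,2)]
    by (simp add: z g_zero_left)
  from frame_extension[OF e(1,2) this] show ?thesis using o by blast
qed

lemma frame_at: "\<exists>E1 E2 U. frame E1 E2 U \<and> p \<in> U"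
proof -
  obtain c where c: "c \<in> A" "p \<in> fst c" by (rule chart_at)
  let ?u = "\<lambda>i. lift c p (axis i 1)"
  have "a = 0 \<and> b = 0" if "a *\<^sub>T ?u 1 + b *\<^sub>T ?u 2 = 0" for a b
  proof -
    have "(a *\<^sub>T ?u 1 + b *\<^sub>T ?u 2) c = 0" using that by simp
    then have "a *\<^sub>R axis 1 1 + b *\<^sub>R axis 2 1 = (0 :: real^2)"
      by (simp add: tscale_def lift_chart c)
    then show ?thesis by (simp add: vec_eq_iff forall_2 axis_def)
  qed
  from frame_extension[OF lift_in[OF c] lift_in[OF c] this] show ?thesis by blast
qed

lemma orthonormal_basis_exists: "\<exists>e1 e2. orthonormal_basis A \<gamma> p e1 e2"
  using frame_at[of p] unfolding frame_def orthonormal_basis_def by (metis vector_field_tangent)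

lemma frameD:
  assumes "frame E1 E2 U"
  shows "E1 \<in> VF" "E2 \<in> VF" "open U" "E1 p \<in> T p" "E2 p \<in> T p"
    "p \<in> U \<Longrightarrow> \<gamma> p (E1 p) (E1 p) = 1" "p \<in> U \<Longrightarrow> \<gamma> p (E2 p) (E2 p) = 1"
    "p \<in> U \<Longrightarrow> \<gamma> p (E1 p) (E2 p) = 0" "p \<in> U \<Longrightarrow> \<gamma> p (E2 p) (E1 p) = 0"
  using assms g_sym[of "E2 p" p "E1 p"] by (auto simp: frame_def vector_field_tangent)

text \<open>Here dimension two enters. The remainder \<open>w\<close> of the projection is
  orthogonal to the frame, and Cramer's relation makes \<open>w\<close>, \<open>E1 p\<close> and
  \<open>E2 p\<close> dependent, with the nonzero determinant of the frame as coefficient at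
  \<open>w\<close>. Pairing the relation with \<open>w\<close> leaves only the squared length of
  \<open>w\<close>.\<close>

lemma frame_expand:
  assumes fr: "frame E1 E2 U" "p \<in> U" and v: "v \<in> T p"
  shows "v = \<gamma> p v (E1 p) *\<^sub>T E1 p + \<gamma> p v (E2 p) *\<^sub>T E2 p"
proof -
  note f = frameD(1-3)[OF fr(1)] frameD(4-9)[OF fr(1), of p]
  obtain c where c: "c \<in> A" "p \<in> fst c" by (rule chart_at)
  define w where "w = v - (\<gamma> p v (E1 p) *\<^sub>T E1 p + \<gamma> p v (E2 p) *\<^sub>T E2 p)"
  have w: "w \<in> T p" unfolding w_def by (intro T_intros v f)
  have w1: "\<gamma> p w (E1 p) = 0" "\<gamma> p w (E2 p) = 0"
    unfolding w_def using f fr(2) v by (simp_all add: g_simps T_intros)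
  let ?x = "E1 p c" and ?y = "E2 p c"
  let ?d = "?x$1 * ?y$2 - ?x$2 * ?y$1"
  have d0: "?d \<noteq> 0"
  proof
    assume d: "?d = 0"
    \<comment> \<open>If the determinant vanishes, so does this combination, for each coordinate
      \<open>i\<close>. Pairing it with \<open>E2 p\<close> shows that the \<open>i\<close>-th
      component of \<open>E1 p\<close> is 0.\<close>
    have "(- (?y$i)) *\<^sub>T E1 p + ?x$i *\<^sub>T E2 p = 0" for i
    proof (rule tangent_eqI[OF tangent_lincomb[OF f(4,5)] T_zero c])
      show "((- (?y$i)) *\<^sub>T E1 p + ?x$i *\<^sub>T E2 p) c = 0 c"
        using d exhaust_2[of i] by (auto simp: tscale_def vec_eq_iff forall_2 algebra_simps)
    qed
    then have "?x$i = 0" for i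
      using g_lincomb[OF f(4,5,5), of "- (?y$i)" "?x$i"] f fr(2) by (simp add: g_zero_left)
    then have "E1 p c = 0" by (simp add: vec_eq_iff)
    then have "E1 p = 0" using f by (intro tangent_eqI[OF _ T_zero c]) auto
    then show False using f(6)[OF fr(2)] by (simp add: g_zero_left T_zero)
  qed
  let ?a = "?y$1 * w c$2 - ?y$2 * w c$1" and ?b = "w c$1 * ?x$2 - w c$2 * ?x$1"
  have "?d *\<^sub>T w + (?a *\<^sub>T E1 p + ?b *\<^sub>T E2 p) = 0"
  proof (rule tangent_eqI[OF _ T_zero c])
    show "?d *\<^sub>T w + (?a *\<^sub>T E1 p + ?b *\<^sub>T E2 p) \<in> T p" by (intro T_intros w f)
    show "(?d *\<^sub>T w + (?a *\<^sub>T E1 p + ?b *\<^sub>T E2 p)) c = 0 c"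
      by (simp add: tscale_def vec_eq_iff forall_2 algebra_simps)
  qed
  then have "\<gamma> p w (?d *\<^sub>T w + (?a *\<^sub>T E1 p + ?b *\<^sub>T E2 p)) = 0"
    using w by (simp add: g_sym[of w p 0] T_zero g_zero_left)
  then have "?d * \<gamma> p w w = 0"
    using w w1 f by (simp add: g_simps T_intros)
  then have "w = 0" using d0 g_pos[OF w] by auto
  then show ?thesis by (simp add: w_def)
qed

lemma frame_eqI:
  assumes "frame E1 E2 U" "p \<in> U" "u \<in> T p" "v \<in> T p"
    "\<gamma> p u (E1 p) = \<gamma> p v (E1 p)" "\<gamma> p u (E2 p) = \<gamma> p v (E2 p)"
  shows "u = v"
  using frame_expand[OF assms(1,2,3)] frame_expand[OF assms(1,2,4)] assms(5,6) by simp

lemma frame_inner: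
  assumes "frame E1 E2 U" "p \<in> U" "u \<in> T p" "v \<in> T p"
  shows "\<gamma> p u v = \<gamma> p u (E1 p) * \<gamma> p v (E1 p) + \<gamma> p u (E2 p) * \<gamma> p v (E2 p)"
proof -
  have "\<gamma> p u v = \<gamma> p u (\<gamma> p v (E1 p) *\<^sub>T E1 p + \<gamma> p v (E2 p) *\<^sub>T E2 p)"
    using frame_expand[OF assms(1,2,4)] by simp
  also have "\<dots> = \<gamma> p v (E1 p) * \<gamma> p u (E1 p) + \<gamma> p v (E2 p) * \<gamma> p u (E2 p)"
    using frameD(4,5)[OF assms(1), of p] assms by (simp only: g_simps T_intros)
  finally show ?thesis by (simp add: mult.commute)
qed

lemma frame_dd:
  assumes "frame E1 E2 U" "p \<in> U" "v \<in> T p" "smooth_fun A f"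
  shows "dd p v f = \<gamma> p v (E1 p) * dd p (E1 p) f + \<gamma> p v (E2 p) * dd p (E2 p) f"
  using dd_lincomb[OF assms(4) frameD(4,5)[OF assms(1), of p]] frame_expand[OF assms(1-3)] by metis

abbreviation ip :: "'a vfield \<Rightarrow> 'a vfield \<Rightarrow> 'a \<Rightarrow> real"
  where "ip X Y \<equiv> \<lambda>p. \<gamma> p (X p) (Y p)"

text \<open>\<open>half\<close> expands the second argument by the Leibniz rule. Antisymmetry brings
  the brackets of \<open>X\<close> with the frame fields into the same shape, so \<open>half\<close>
  expands \<open>X\<close> as well, and only the bracket of the frame fields is left.\<close>

lemma lie_frame:
  assumes fr: "frame E1 E2 U" "p \<in> U" and X: "X \<in> VF" and Y: "Y \<in> VF"
  shows "lie X Y p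
    = (dd p (X p) (ip Y E1) - dd p (Y p) (ip X E1)) *\<^sub>T E1 p
    + (dd p (X p) (ip Y E2) - dd p (Y p) (ip X E2)) *\<^sub>T E2 p
    + (ip X E1 p * ip Y E2 p - ip X E2 p * ip Y E1 p) *\<^sub>T lie E1 E2 p"
proof -
  note f = frameD[OF fr(1)]
  have half: "lie Z W p = ip W E1 p *\<^sub>T lie Z E1 p + dd p (Z p) (ip W E1) *\<^sub>T E1 p
      + (ip W E2 p *\<^sub>T lie Z E2 p + dd p (Z p) (ip W E2) *\<^sub>T E2 p)"
    if Z: "Z \<in> VF" and W: "W \<in> VF" for Z W
  proof -
    have s: "(\<lambda>q. ip W E1 q *\<^sub>T E1 q) \<in> VF" "(\<lambda>q. ip W E2 q *\<^sub>T E2 q) \<in> VF"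
      by (intro VF_scale smooth_fun_g W f)+
    \<comment> \<open>The expansion of \<open>W\<close> holds on \<open>U\<close> only, hence
      \<open>lie_local\<close>.\<close>
    have "lie Z W p = lie Z (\<lambda>q. ip W E1 q *\<^sub>T E1 q + ip W E2 q *\<^sub>T E2 q) p"
      by (rule lie_local[OF Z W Z VF_add[OF s] f(3) fr(2)])
        (use frame_expand[OF fr(1)] vector_field_tangent[OF W] in auto)
    then show ?thesis
      using Z W f by (simp add: lie_add_right s lie_scale_right smooth_fun_g)
  qed
  have alg: "y1 *\<^sub>T - (a11 *\<^sub>T e1 + (x2 *\<^sub>T b + a12 *\<^sub>T e2)) + d1 *\<^sub>T e1
      + (y2 *\<^sub>T - (x1 *\<^sub>T - b + a21 *\<^sub>T e1 + a22 *\<^sub>T e2) + d2 *\<^sub>T e2)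
    = (d1 - (y1 * a11 + y2 * a21)) *\<^sub>T e1 + (d2 - (y1 * a12 + y2 * a22)) *\<^sub>T e2
      + (x1 * y2 - x2 * y1) *\<^sub>T b" for x1 x2 y1 y2 a11 a12 a21 a22 d1 d2 and e1 e2 b :: "'a tvec"
    by (rule ext) (simp add: tscale_def algebra_simps)
  have self: "lie Z Z p = 0" for Z by (auto simp: lie_bracket_def)
  have 1: "lie X E1 p = - (dd p (E1 p) (ip X E1) *\<^sub>T E1 p
      + (ip X E2 p *\<^sub>T lie E1 E2 p + dd p (E1 p) (ip X E2) *\<^sub>T E2 p))"
    using half[OF f(1) X] lie_antisym[of X E1 p] by (simp add: self)
  have 2: "lie X E2 p = - (ip X E1 p *\<^sub>T - lie E1 E2 p + dd p (E2 p) (ip X E1) *\<^sub>T E1 p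
      + dd p (E2 p) (ip X E2) *\<^sub>T E2 p)"
    using half[OF f(2) X] lie_antisym[of X E2 p] lie_antisym[of E2 E1 p] by (simp add: self)
  have dY: "dd p (Y p) (ip X E1) = ip Y E1 p * dd p (E1 p) (ip X E1) + ip Y E2 p * dd p (E2 p) (ip X E1)"
    "dd p (Y p) (ip X E2) = ip Y E1 p * dd p (E1 p) (ip X E2) + ip Y E2 p * dd p (E2 p) (ip X E2)"
    using frame_dd[OF fr vector_field_tangent[OF Y]] smooth_fun_g X f by blast+
  show ?thesis
    unfolding half[OF X Y] 1 2 dY by (rule alg)
qed

section \<open>One-forms and their exterior derivatives\<close>

definition one_form :: "('a \<Rightarrow> 'a tvec \<Rightarrow> real) \<Rightarrow> bool" where
  "one_form \<alpha> \<longleftrightarrow> (\<forall>p. \<forall>u\<in>T p. \<forall>v\<in>T p. \<forall>a b. \<alpha> p (a *\<^sub>T u + b *\<^sub>T v) = a * \<alpha> p u + b * \<alpha> p v) \<and>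
     (\<forall>X\<in>VF. smooth_fun A (\<lambda>p. \<alpha> p (X p)))"

definition ext_deriv :: "('a \<Rightarrow> 'a tvec \<Rightarrow> real) \<Rightarrow> 'a vfield \<Rightarrow> 'a vfield \<Rightarrow> 'a \<Rightarrow> real" where
  "ext_deriv \<alpha> X Y p =
     dd p (X p) (\<lambda>q. \<alpha> q (Y q)) - dd p (Y p) (\<lambda>q. \<alpha> q (X q)) - \<alpha> p (lie X Y p)"

lemma one_form_frame:
  assumes "one_form \<alpha>" "frame E1 E2 U" "p \<in> U" "v \<in> T p"
  shows "\<alpha> p v = \<gamma> p v (E1 p) * \<alpha> p (E1 p) + \<gamma> p v (E2 p) * \<alpha> p (E2 p)"
proof -
  have "\<alpha> p v = \<alpha> p (\<gamma> p v (E1 p) *\<^sub>T E1 p + \<gamma> p v (E2 p) *\<^sub>T E2 p)"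
    using frame_expand[OF assms(2-4)] by simp
  then show ?thesis
    using assms(1) frameD(4,5)[OF assms(2), of p] unfolding one_form_def by simp
qed

text \<open>The derivatives of the components of \<open>X\<close> and \<open>Y\<close> cancel
  against those in \<open>lie_frame\<close>. The factor that survives is a determinant of values at
  \<open>p\<close>: the exterior derivative is tensorial.\<close>

lemma ext_deriv_frame:
  assumes \<alpha>: "one_form \<alpha>" and fr: "frame E1 E2 U" "p \<in> U" and X: "X \<in> VF" and Y: "Y \<in> VF"
  shows "ext_deriv \<alpha> X Y p = (ip X E1 p * ip Y E2 p - ip X E2 p * ip Y E1 p) * ext_deriv \<alpha> E1 E2 p"
proof -
  note f = frameD[OF fr(1)]
  let ?a1 = "\<lambda>q. \<alpha> q (E1 q)" and ?a2 = "\<lambda>q. \<alpha> q (E2 q)"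
  have s: "smooth_fun A (\<lambda>q. \<alpha> q (Z q))" if "Z \<in> VF" for Z
    using \<alpha> that by (simp add: one_form_def)
  have d: "dd p (Z p) (\<lambda>q. \<alpha> q (W q)) = ip W E1 p * dd p (Z p) ?a1 + dd p (Z p) (ip W E1) * ?a1 p
      + (ip W E2 p * dd p (Z p) ?a2 + dd p (Z p) (ip W E2) * ?a2 p)"
    if Z: "Z \<in> VF" and W: "W \<in> VF" for Z W
  proof -
    have "dd p (Z p) (\<lambda>q. \<alpha> q (W q)) = dd p (Z p) (\<lambda>q. ip W E1 q * ?a1 q + ip W E2 q * ?a2 q)"
    proof (rule dd_local[OF s[OF W] _ vector_field_tangent[OF Z] f(3) fr(2)])
      show "smooth_fun A (\<lambda>q. ip W E1 q * ?a1 q + ip W E2 q * ?a2 q)"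
        by (intro smooth_fun_add smooth_fun_mult smooth_fun_g s W f)
      show "\<alpha> q (W q) = ip W E1 q * ?a1 q + ip W E2 q * ?a2 q" if "q \<in> U" for q
        by (rule one_form_frame[OF \<alpha> fr(1) that vector_field_tangent[OF W]])
    qed
    then show ?thesis
      using vector_field_tangent[OF Z] W f
      by (simp add: dd_add dd_mult smooth_fun_mult smooth_fun_g s)
  qed
  have l: "\<alpha> p (lie X Y p) = (dd p (X p) (ip Y E1) - dd p (Y p) (ip X E1)) * ?a1 p
    + (dd p (X p) (ip Y E2) - dd p (Y p) (ip X E2)) * ?a2 p
    + (ip X E1 p * ip Y E2 p - ip X E2 p * ip Y E1 p) * \<alpha> p (lie E1 E2 p)"
  proof -
    have lin: "\<alpha> p (a *\<^sub>T u + b *\<^sub>T v) = a * \<alpha> p u + b * \<alpha> p v" if "u \<in> T p" "v \<in> T p" for a b u v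
      using \<alpha> that by (simp add: one_form_def)
    have lin3: "\<alpha> p (a *\<^sub>T u + b *\<^sub>T v + e *\<^sub>T w) = a * \<alpha> p u + b * \<alpha> p v + e * \<alpha> p w"
      if "u \<in> T p" "v \<in> T p" "w \<in> T p" for a b e u v w
      using lin[OF tangent_lincomb[OF that(1,2), of a b] that(3), of 1 e] lin[OF that(1,2), of a b] by simp
    show ?thesis
      unfolding lie_frame[OF fr X Y] by (rule lin3) (intro f lie_tangent)+
  qed
  have x: "dd p (Z p) ?a1 = ip Z E1 p * dd p (E1 p) ?a1 + ip Z E2 p * dd p (E2 p) ?a1"
    "dd p (Z p) ?a2 = ip Z E1 p * dd p (E1 p) ?a2 + ip Z E2 p * dd p (E2 p) ?a2" if "Z \<in> VF" for Z
    using frame_dd[OF fr vector_field_tangent[OF that] s] f by blast+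
  show ?thesis
    unfolding ext_deriv_def d[OF X Y] d[OF Y X] l x[OF X] x[OF Y] by (simp add: algebra_simps)
qed

lemma ext_deriv_diff:
  assumes "one_form \<alpha>" "one_form \<beta>" "X \<in> VF" "Y \<in> VF"
  shows "ext_deriv (\<lambda>p v. \<alpha> p v - \<beta> p v) X Y p = ext_deriv \<alpha> X Y p - ext_deriv \<beta> X Y p"
  using assms by (simp add: ext_deriv_def dd_diff vector_field_tangent one_form_def)

section \<open>Metric connections\<close>

definition conn_form :: "'a connection \<Rightarrow> 'a vfield \<Rightarrow> 'a vfield \<Rightarrow> 'a \<Rightarrow> 'a tvec \<Rightarrow> real" where
  "conn_form D E1 E2 = (\<lambda>p v. \<gamma> p (D E1 p v) (E2 p))"

lemma connD:
  assumes "linear_connection A D"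
  shows "Y \<in> VF \<Longrightarrow> v \<in> T p \<Longrightarrow> D Y p v \<in> T p"
    "X \<in> VF \<Longrightarrow> Y \<in> VF \<Longrightarrow> cov D X Y \<in> VF"
    "Y \<in> VF \<Longrightarrow> u \<in> T p \<Longrightarrow> v \<in> T p \<Longrightarrow> D Y p (a *\<^sub>T u + b *\<^sub>T v) = a *\<^sub>T D Y p u + b *\<^sub>T D Y p v"
    "Y \<in> VF \<Longrightarrow> Z \<in> VF \<Longrightarrow> v \<in> T p \<Longrightarrow> D (Y + Z) p v = D Y p v + D Z p v"
    "smooth_fun A f \<Longrightarrow> Y \<in> VF \<Longrightarrow> v \<in> T p \<Longrightarrow>
      D (\<lambda>q. f q *\<^sub>T Y q) p v = dd p v f *\<^sub>T Y p + f p *\<^sub>T D Y p v"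
  using assms unfolding linear_connection_def by blast+

lemma metric_connD:
  "metric_connection A \<gamma> D \<Longrightarrow> Y \<in> VF \<Longrightarrow> Z \<in> VF \<Longrightarrow> v \<in> T p
    \<Longrightarrow> dd p v (ip Y Z) = \<gamma> p (D Y p v) (Z p) + \<gamma> p (Y p) (D Z p v)"
  unfolding metric_connection_def by blast

lemma one_form_conn_form:
  assumes "linear_connection A D" "E1 \<in> VF" "E2 \<in> VF"
  shows "one_form (conn_form D E1 E2)"
  unfolding one_form_def
proof (intro conjI allI ballI)
  fix p u v a b assume t: "u \<in> T p" "v \<in> T p"
  show "conn_form D E1 E2 p (a *\<^sub>T u + b *\<^sub>T v)
      = a * conn_form D E1 E2 p u + b * conn_form D E1 E2 p v"
    unfolding conn_form_def connD(3)[OF assms(1,2) t]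
    by (intro g_lincomb connD(1)[OF assms(1,2)] t vector_field_tangent assms(3))
next
  fix X assume "X \<in> VF"
  then show "smooth_fun A (\<lambda>p. conn_form D E1 E2 p (X p))"
    using smooth_fun_g[OF connD(2)[OF assms(1) _ assms(2)] assms(3)] by (simp add: conn_form_def cov_def)
qed

text \<open>Differentiate the inner products of the frame fields, which are constant on
  \<open>U\<close>.\<close>

lemma conn_frame_basis:
  assumes D: "linear_connection A D" "metric_connection A \<gamma> D"
    and fr: "frame E1 E2 U" "p \<in> U" and v: "v \<in> T p"
  shows "\<gamma> p (D E1 p v) (E1 p) = 0" and "\<gamma> p (D E2 p v) (E2 p) = 0"
    and "\<gamma> p (D E2 p v) (E1 p) = - conn_form D E1 E2 p v"
proof -
  note fV = frameD(1-3)[OF fr(1)] and f = frameD(4-9)[OF fr(1), of p]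
  note t = connD(1)[OF D(1) fV(1) v] connD(1)[OF D(1) fV(2) v]
  have const: "dd p v h = 0" if "smooth_fun A h" "\<And>q. q \<in> U \<Longrightarrow> h q = a" for h a
    using dd_local[OF that(1) smooth_fun_const v fV(3) fr(2) that(2)] v by (simp add: dd_const)
  show "\<gamma> p (D E1 p v) (E1 p) = 0"
    using metric_connD[OF D(2) fV(1) fV(1) v] const[OF smooth_fun_g[OF fV(1) fV(1)], of 1]
      frameD(6)[OF fr(1)] g_sym[OF t(1) f(1)] by simp
  show "\<gamma> p (D E2 p v) (E2 p) = 0"
    using metric_connD[OF D(2) fV(2) fV(2) v] const[OF smooth_fun_g[OF fV(2) fV(2)], of 1]
      frameD(7)[OF fr(1)] g_sym[OF t(2) f(2)] by simp
  show "\<gamma> p (D E2 p v) (E1 p) = - conn_form D E1 E2 p v"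
    using metric_connD[OF D(2) fV(1) fV(2) v] const[OF smooth_fun_g[OF fV(1) fV(2)], of 0]
      frameD(8)[OF fr(1)] g_sym[OF t(2) f(1)] by (simp add: conn_form_def)
qed

text \<open>The metric rule is applied to \<open>Y\<close> and a frame field, both global. Expanding
  \<open>Y\<close> in the frame instead would use an identity on \<open>U\<close> inside
  \<open>D\<close>, and so presuppose that \<open>D\<close> is local.\<close>

lemma conn_frame:
  assumes D: "linear_connection A D" "metric_connection A \<gamma> D"
    and fr: "frame E1 E2 U" "p \<in> U" and v: "v \<in> T p" and Y: "Y \<in> VF"
  shows "\<gamma> p (D Y p v) (E1 p) = dd p v (ip Y E1) - ip Y E2 p * conn_form D E1 E2 p v"
    and "\<gamma> p (D Y p v) (E2 p) = dd p v (ip Y E2) + ip Y E1 p * conn_form D E1 E2 p v"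
proof -
  note fV = frameD(1-3)[OF fr(1)]
  note t = connD(1)[OF D(1) fV(1) v] connD(1)[OF D(1) fV(2) v]
  note i = frame_inner[OF fr vector_field_tangent[OF Y]] and b = conn_frame_basis[OF D fr v]
  show "\<gamma> p (D Y p v) (E1 p) = dd p v (ip Y E1) - ip Y E2 p * conn_form D E1 E2 p v"
    using metric_connD[OF D(2) Y fV(1) v] i[OF t(1)] b(1) by (simp add: conn_form_def)
  show "\<gamma> p (D Y p v) (E2 p) = dd p v (ip Y E2) + ip Y E1 p * conn_form D E1 E2 p v"
    using metric_connD[OF D(2) Y fV(2) v] i[OF t(2)] b(2,3) by simp
qed

lemma curvature_tangent:
  assumes "linear_connection A D" "X \<in> VF" "Y \<in> VF" "Z \<in> VF"
  shows "curvature A D X Y Z p \<in> T p"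
  using assms by (simp add: curvature_def T_diff vector_field_tangent connD(2) VF_lie)

text \<open>\<open>conn_frame\<close> is applied twice. Antisymmetrising in \<open>X\<close> and
  \<open>Y\<close> cancels the products of two values of the connection form, as rotations of a
  plane commute; \<open>dd_lie\<close> removes the second derivatives of the components of
  \<open>Z\<close>. The derivative of the form remains.\<close>

lemma curvature_frame:
  assumes D: "linear_connection A D" "metric_connection A \<gamma> D"
    and fr: "frame E1 E2 U" "p \<in> U" and X: "X \<in> VF" and Y: "Y \<in> VF" and Z: "Z \<in> VF"
  shows "\<gamma> p (curvature A D X Y Z p) (E1 p) = - ip Z E2 p * ext_deriv (conn_form D E1 E2) X Y p"
    and "\<gamma> p (curvature A D X Y Z p) (E2 p) = ip Z E1 p * ext_deriv (conn_form D E1 E2) X Y p"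
proof -
  note fV = frameD(1-3)[OF fr(1)] and f = frameD(4-9)[OF fr(1), of p]
  define w where "w = conn_form D E1 E2"
  have w: "one_form w" unfolding w_def by (intro one_form_conn_form D fV)
  have ws: "smooth_fun A (\<lambda>q. w q (X q))" if "X \<in> VF" for X
    using w that by (simp add: one_form_def)
  note cf = conn_frame[OF D fr(1), folded w_def]
  note s = smooth_fun_g[OF Z fV(1)] smooth_fun_g[OF Z fV(2)]
  have two: "\<gamma> p (cov D X (cov D Y Z) p) (E1 p) = dd p (X p) (\<lambda>q. dd q (Y q) (ip Z E1))
       - (ip Z E2 p * dd p (X p) (\<lambda>q. w q (Y q)) + dd p (X p) (ip Z E2) * w p (Y p))
       - (dd p (Y p) (ip Z E2) + ip Z E1 p * w p (Y p)) * w p (X p)"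
    "\<gamma> p (cov D X (cov D Y Z) p) (E2 p) = dd p (X p) (\<lambda>q. dd q (Y q) (ip Z E2))
       + (ip Z E1 p * dd p (X p) (\<lambda>q. w q (Y q)) + dd p (X p) (ip Z E1) * w p (Y p))
       + (dd p (Y p) (ip Z E1) - ip Z E2 p * w p (Y p)) * w p (X p)"
    if X: "X \<in> VF" and Y: "Y \<in> VF" for X Y
  proof -
    let ?W = "cov D Y Z"
    have W: "?W \<in> VF" by (rule connD(2)[OF D(1) Y Z])
    note Xp = vector_field_tangent[OF X, of p] and Yq = vector_field_tangent[OF Y]
    have c: "ip ?W E1 q = dd q (Y q) (ip Z E1) - ip Z E2 q * w q (Y q)"
      "ip ?W E2 q = dd q (Y q) (ip Z E2) + ip Z E1 q * w q (Y q)" if "q \<in> U" for q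
      using cf[OF that Yq Z] by (simp_all add: cov_def)
    have "dd p (X p) (ip ?W E1) = dd p (X p) (\<lambda>q. dd q (Y q) (ip Z E1) - ip Z E2 q * w q (Y q))"
      by (rule dd_local[OF smooth_fun_g[OF W fV(1)] _ Xp fV(3) fr(2) c(1)])
        (intro smooth_fun_diff smooth_fun_mult smooth_fun_dd Y s ws)
    moreover have "dd p (X p) (ip ?W E2) = dd p (X p) (\<lambda>q. dd q (Y q) (ip Z E2) + ip Z E1 q * w q (Y q))"
      by (rule dd_local[OF smooth_fun_g[OF W fV(2)] _ Xp fV(3) fr(2) c(2)])
        (intro smooth_fun_add smooth_fun_mult smooth_fun_dd Y s ws)
    moreover have "\<gamma> p (cov D X ?W p) (E1 p) = dd p (X p) (ip ?W E1) - ip ?W E2 p * w p (X p)"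
      "\<gamma> p (cov D X ?W p) (E2 p) = dd p (X p) (ip ?W E2) + ip ?W E1 p * w p (X p)"
      using cf[OF fr(2) Xp W] by (simp_all add: cov_def)
    ultimately show "\<gamma> p (cov D X ?W p) (E1 p) = dd p (X p) (\<lambda>q. dd q (Y q) (ip Z E1))
       - (ip Z E2 p * dd p (X p) (\<lambda>q. w q (Y q)) + dd p (X p) (ip Z E2) * w p (Y p))
       - (dd p (Y p) (ip Z E2) + ip Z E1 p * w p (Y p)) * w p (X p)"
      "\<gamma> p (cov D X (cov D Y Z) p) (E2 p) = dd p (X p) (\<lambda>q. dd q (Y q) (ip Z E2))
       + (ip Z E1 p * dd p (X p) (\<lambda>q. w q (Y q)) + dd p (X p) (ip Z E1) * w p (Y p))
       + (dd p (Y p) (ip Z E1) - ip Z E2 p * w p (Y p)) * w p (X p)"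
      using c[OF fr(2)] Xp Y
      by (simp_all add: dd_diff dd_add dd_mult smooth_fun_mult smooth_fun_dd s ws)
  qed
  have three: "\<gamma> p (cov D (lie X Y) Z p) (E1 p) = dd p (X p) (\<lambda>q. dd q (Y q) (ip Z E1))
      - dd p (Y p) (\<lambda>q. dd q (X q) (ip Z E1)) - ip Z E2 p * w p (lie X Y p)"
    "\<gamma> p (cov D (lie X Y) Z p) (E2 p) = dd p (X p) (\<lambda>q. dd q (Y q) (ip Z E2))
      - dd p (Y p) (\<lambda>q. dd q (X q) (ip Z E2)) + ip Z E1 p * w p (lie X Y p)"
    using cf[OF fr(2) lie_tangent[OF X Y] Z] dd_lie[OF X Y s(1)] dd_lie[OF X Y s(2)]
    by (simp_all add: cov_def)
  have t: "cov D X W p \<in> T p" if "X \<in> VF" "W \<in> VF" for X W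
    using that by (intro vector_field_tangent connD(2) D)
  have "\<gamma> p (curvature A D X Y Z p) e = \<gamma> p (cov D X (cov D Y Z) p) e
      - \<gamma> p (cov D Y (cov D X Z) p) e - \<gamma> p (cov D (lie X Y) Z p) e" if "e \<in> T p" for e
    using that X Y Z by (simp add: curvature_def g_diff_left T_diff t connD(2)[OF D(1)] VF_lie)
  note cu = this[OF f(1)] this[OF f(2)]
  show "\<gamma> p (curvature A D X Y Z p) (E1 p) = - ip Z E2 p * ext_deriv (conn_form D E1 E2) X Y p"
    unfolding cu two(1)[OF X Y] two(1)[OF Y X] three(1) w_def[symmetric] ext_deriv_def
    by (simp add: algebra_simps)
  show "\<gamma> p (curvature A D X Y Z p) (E2 p) = ip Z E1 p * ext_deriv (conn_form D E1 E2) X Y p"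
    unfolding cu two(2)[OF X Y] two(2)[OF Y X] three(2) w_def[symmetric] ext_deriv_def
    by (simp add: algebra_simps)
qed

section \<open>The Levi-Civita connection\<close>

text \<open>A torsion-free metric connection with connection form w satisfies [E1,E2] = - w(E1) E1 -
  w(E2) E2, which forces w(v) to be \<open>- \<gamma> p (lie E1 E2 p) v\<close>. The definition is
  the formula of \<open>conn_frame\<close> with this form.\<close>

definition frame_conn :: "'a vfield \<Rightarrow> 'a vfield \<Rightarrow> 'a connection" where
  "frame_conn E1 E2 Y p v =
     (dd p v (ip Y E1) + ip Y E2 p * \<gamma> p (lie E1 E2 p) v) *\<^sub>T E1 p +
     (dd p v (ip Y E2) - ip Y E1 p * \<gamma> p (lie E1 E2 p) v) *\<^sub>T E2 p"

lemma frame_conn_tangent: "frame E1 E2 U \<Longrightarrow> frame_conn E1 E2 Y p v \<in> T p"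
  unfolding frame_conn_def by (intro T_add T_scale frameD)

lemma frame_conn_components:
  assumes "frame E1 E2 U" "p \<in> U"
  shows "\<gamma> p (frame_conn E1 E2 Y p v) (E1 p) = dd p v (ip Y E1) + ip Y E2 p * \<gamma> p (lie E1 E2 p) v"
    "\<gamma> p (frame_conn E1 E2 Y p v) (E2 p) = dd p v (ip Y E2) - ip Y E1 p * \<gamma> p (lie E1 E2 p) v"
  using frameD(4-9)[OF assms(1), of p] assms(2) by (simp_all add: frame_conn_def g_lincomb)

lemma frame_conn_metric:
  assumes fr: "frame E1 E2 U" "p \<in> U" and v: "v \<in> T p" and Y: "Y \<in> VF" and Z: "Z \<in> VF"
  shows "dd p v (ip Y Z) = \<gamma> p (frame_conn E1 E2 Y p v) (Z p) + \<gamma> p (Y p) (frame_conn E1 E2 Z p v)"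
proof -
  note fV = frameD(1-3)[OF fr(1)] and t = vector_field_tangent[OF Y] vector_field_tangent[OF Z]
  have "dd p v (ip Y Z) = dd p v (\<lambda>q. ip Y E1 q * ip Z E1 q + ip Y E2 q * ip Z E2 q)"
    by (rule dd_local[OF smooth_fun_g[OF Y Z] _ v fV(3) fr(2) frame_inner[OF fr(1) _ t]])
      (intro smooth_fun_add smooth_fun_mult smooth_fun_g Y Z fV)
  also have "\<dots> = ip Y E1 p * dd p v (ip Z E1) + dd p v (ip Y E1) * ip Z E1 p
      + (ip Y E2 p * dd p v (ip Z E2) + dd p v (ip Y E2) * ip Z E2 p)"
    using v Y Z fV by (simp add: dd_add dd_mult smooth_fun_mult smooth_fun_g)
  finally show ?thesis
    unfolding frame_inner[OF fr frame_conn_tangent[OF fr(1)] t(2)]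
      frame_inner[OF fr t(1) frame_conn_tangent[OF fr(1)]] frame_conn_components[OF fr]
    by (simp add: algebra_simps)
qed

text \<open>After expansion in the frame, the form chosen in \<open>frame_conn\<close> contributes a
  determinant times the bracket of the frame fields, which is the last term of
  \<open>lie_frame\<close>.\<close>

lemma frame_conn_torsion:
  assumes fr: "frame E1 E2 U" "p \<in> U" and X: "X \<in> VF" and Y: "Y \<in> VF"
  shows "frame_conn E1 E2 Y p (X p) - frame_conn E1 E2 X p (Y p) = lie X Y p"
proof -
  note fV = frameD(1-3)[OF fr(1)] and f = frameD(4-9)[OF fr(1), of p]
  note B = lie_tangent[OF fV(1,2), of p]
  have b: "\<gamma> p (lie E1 E2 p) (Z p) = \<gamma> p (lie E1 E2 p) (E1 p) * ip Z E1 p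
      + \<gamma> p (lie E1 E2 p) (E2 p) * ip Z E2 p" if "Z \<in> VF" for Z
    by (rule frame_inner[OF fr B vector_field_tangent[OF that]])
  note fc = frame_conn_tangent[OF fr(1)]
  show ?thesis
  proof (rule frame_eqI[OF fr T_diff[OF fc fc] lie_tangent[OF X Y]])
    show "\<gamma> p (frame_conn E1 E2 Y p (X p) - frame_conn E1 E2 X p (Y p)) (E1 p) = \<gamma> p (lie X Y p) (E1 p)"
      using f fr(2) B by (simp add: lie_frame[OF fr X Y] g_add_left g_scale_left g_diff_left T_add T_scale
          fc frame_conn_components[OF fr] b[OF X] b[OF Y]) (simp add: algebra_simps)
    show "\<gamma> p (frame_conn E1 E2 Y p (X p) - frame_conn E1 E2 X p (Y p)) (E2 p) = \<gamma> p (lie X Y p) (E2 p)"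
      using f fr(2) B by (simp add: lie_frame[OF fr X Y] g_add_left g_scale_left g_diff_left T_add T_scale
          fc frame_conn_components[OF fr] b[OF X] b[OF Y]) (simp add: algebra_simps)
  qed
qed

text \<open>
  The difference of two candidates, paired with a third field, is symmetric in its first two
  arguments and skew in the last two, hence zero.
\<close>

lemma levi_civita_unique_at:
  assumes t: "\<And>Y v. Y \<in> VF \<Longrightarrow> v \<in> T p \<Longrightarrow> P Y v \<in> T p" "\<And>Y v. Y \<in> VF \<Longrightarrow> v \<in> T p \<Longrightarrow> Q Y v \<in> T p"
    and m: "\<And>Y Z v. Y \<in> VF \<Longrightarrow> Z \<in> VF \<Longrightarrow> v \<in> T p \<Longrightarrow>
        dd p v (ip Y Z) = \<gamma> p (P Y v) (Z p) + \<gamma> p (Y p) (P Z v)"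
      "\<And>Y Z v. Y \<in> VF \<Longrightarrow> Z \<in> VF \<Longrightarrow> v \<in> T p \<Longrightarrow>
        dd p v (ip Y Z) = \<gamma> p (Q Y v) (Z p) + \<gamma> p (Y p) (Q Z v)"
    and s: "\<And>X Y. X \<in> VF \<Longrightarrow> Y \<in> VF \<Longrightarrow> P Y (X p) - P X (Y p) = lie X Y p"
      "\<And>X Y. X \<in> VF \<Longrightarrow> Y \<in> VF \<Longrightarrow> Q Y (X p) - Q X (Y p) = lie X Y p"
    and Y: "Y \<in> VF" and v: "v \<in> T p"
  shows "P Y v = Q Y v"
proof -
  define S where "S X Y Z = \<gamma> p (P Y (X p) - Q Y (X p)) (Z p)" for X Y Z
  have sym: "S X Y Z = S Y X Z" if "X \<in> VF" "Y \<in> VF" for X Y Z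
  proof -
    have "P Y (X p) = Q Y (X p) - Q X (Y p) + P X (Y p)"
      unfolding s(2)[OF that] s(1)[OF that, symmetric] by simp
    then have "P Y (X p) - Q Y (X p) = P X (Y p) - Q X (Y p)" by simp
    then show ?thesis by (simp add: S_def)
  qed
  have skew: "S X Y Z = - S X Z Y" if "X \<in> VF" "Y \<in> VF" "Z \<in> VF" for X Y Z
  proof -
    note tv = vector_field_tangent[OF that(1), of p] vector_field_tangent[OF that(2), of p]
      vector_field_tangent[OF that(3), of p]
    show ?thesis
      using m(1)[OF that(2,3) tv(1)] m(2)[OF that(2,3) tv(1)] t(1)[OF that(2) tv(1)] t(2)[OF that(2) tv(1)]
        t(1)[OF that(3) tv(1)] t(2)[OF that(3) tv(1)] tv
      by (simp add: S_def g_diff_left g_sym[OF tv(2)])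
  qed
  \<comment> \<open>Alternating the two rules: S X Y Z = S Y X Z = - S Y Z X = - S Z Y X = S Z X Y =
    S X Z Y = - S X Y Z.\<close>
  have zero: "S X Y Z = 0" if "X \<in> VF" "Y \<in> VF" "Z \<in> VF" for X Y Z
    using sym skew that by (smt (verit))
  obtain X where X: "X \<in> VF" "X p = v" using vector_field_extension[OF v] by blast
  have d: "P Y v - Q Y v \<in> T p" by (intro T_diff t Y v)
  obtain Z where Z: "Z \<in> VF" "Z p = P Y v - Q Y v" using vector_field_extension[OF d] by blast
  have "\<gamma> p (P Y v - Q Y v) (P Y v - Q Y v) = 0"
    using zero[OF X(1) Y Z(1)] X Z by (simp add: S_def)
  then have "P Y v - Q Y v = 0" using g_pos[OF d] by auto
  then show ?thesis by simp
qed

text \<open>The metric and torsion rules for \<open>frame_conn\<close> are available only on the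
  open set of its frame. This is why uniqueness was proved at a single point: it compares two frames
  wherever their sets meet.\<close>

lemma frame_conn_unique:
  assumes fr: "frame E1 E2 U" "p \<in> U" and fr': "frame F1 F2 V" "p \<in> V" and Y: "Y \<in> VF" "v \<in> T p"
  shows "frame_conn E1 E2 Y p v = frame_conn F1 F2 Y p v"
  by (rule levi_civita_unique_at[where P="\<lambda>Y v. frame_conn E1 E2 Y p v" and Q="\<lambda>Y v. frame_conn F1 F2 Y p v"])
    (use fr fr' Y in \<open>blast intro: frame_conn_tangent frame_conn_metric frame_conn_torsion\<close>)+

text \<open>The SOME is harmless by \<open>frame_conn_unique\<close>: the local connections coincide
  at common points and need not be averaged.\<close>

definition glued_conn :: "'a connection" where
  "glued_conn Y p v = (SOME z. \<exists>E1 E2 U. frame E1 E2 U \<and> p \<in> U \<and> z = frame_conn E1 E2 Y p v)"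

lemma glued_conn_frame:
  assumes "frame E1 E2 U" "p \<in> U" "Y \<in> VF" "v \<in> T p"
  shows "glued_conn Y p v = frame_conn E1 E2 Y p v"
  unfolding glued_conn_def
  by (rule someI2[where a="frame_conn E1 E2 Y p v"]) (use assms frame_conn_unique in blast)+

lemma linear_connection_glued: "linear_connection A glued_conn"
  unfolding linear_connection_def
proof (intro conjI ballI allI impI)
  fix Y p v assume "Y \<in> VF" "v \<in> T p"
  then show "glued_conn Y p v \<in> T p"
    using frame_at[of p] glued_conn_frame frame_conn_tangent by metis
next
  fix X Y assume X: "X \<in> VF" and Y: "Y \<in> VF"
  show "cov glued_conn X Y \<in> VF"
  proof (rule vector_field_localI)
    fix p
    obtain E1 E2 U where fr: "frame E1 E2 U" "p \<in> U" using frame_at[of p] by blast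
    have f: "E1 \<in> VF" "E2 \<in> VF" "open U" using frameD(1-3)[OF fr(1)] .
    let ?W = "\<lambda>q. frame_conn E1 E2 Y q (X q)"
    \<comment> \<open>The frame fields are global, so this formula defines a smooth field
      everywhere, although it is compared with the glued connection on \<open>U\<close>
      only.\<close>
    have "?W \<in> VF"
      unfolding frame_conn_def
      by (intro VF_add VF_scale smooth_fun_add smooth_fun_diff smooth_fun_mult smooth_fun_dd smooth_fun_g VF_lie X Y f)
    moreover have "cov glued_conn X Y q = ?W q" if "q \<in> U" for q
      unfolding cov_def by (rule glued_conn_frame[OF fr(1) that Y vector_field_tangent[OF X]])
    ultimately show "\<exists>U W. open U \<and> p \<in> U \<and> W \<in> VF \<and> (\<forall>q\<in>U. cov glued_conn X Y q = W q)"
      using f(3) fr(2) by (intro exI[of _ U] exI[of _ ?W]) auto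
  qed
next
  fix Y p u v a b assume Y: "Y \<in> VF" and u: "u \<in> T p" and v: "v \<in> T p"
  obtain E1 E2 U where fr: "frame E1 E2 U" "p \<in> U" using frame_at[of p] by blast
  note fV = frameD(1-3)[OF fr(1)]
  have "frame_conn E1 E2 Y p (a *\<^sub>T u + b *\<^sub>T v) = a *\<^sub>T frame_conn E1 E2 Y p u + b *\<^sub>T frame_conn E1 E2 Y p v"
    using u v fV lie_tangent[OF fV(1,2), of p] Y
    by (simp add: frame_conn_def dd_lincomb smooth_fun_g g_add_right g_scale_right T_scale)
      (simp add: tscale_def fun_eq_iff algebra_simps)
  then show "glued_conn Y p (a *\<^sub>T u + b *\<^sub>T v) = a *\<^sub>T glued_conn Y p u + b *\<^sub>T glued_conn Y p v"
    using glued_conn_frame[OF fr Y] u v tangent_lincomb by metis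
next
  fix Y Z p v assume Y: "Y \<in> VF" and Z: "Z \<in> VF" and v: "v \<in> T p"
  obtain E1 E2 U where fr: "frame E1 E2 U" "p \<in> U" using frame_at[of p] by blast
  note fV = frameD(1-3)[OF fr(1)]
  have YZ: "Y + Z = (\<lambda>q. Y q + Z q)" by (simp add: fun_eq_iff)
  have e: "ip (\<lambda>q. Y q + Z q) E = (\<lambda>q. ip Y E q + ip Z E q)" if "E \<in> VF" for E
    using Y Z that by (simp add: fun_eq_iff g_add_left vector_field_tangent)
  have "frame_conn E1 E2 (\<lambda>q. Y q + Z q) p v = frame_conn E1 E2 Y p v + frame_conn E1 E2 Z p v"
    using v fV Y Z unfolding frame_conn_def
    by (simp add: e dd_add smooth_fun_g g_add_left vector_field_tangent)
      (simp add: tscale_def fun_eq_iff algebra_simps)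
  then show "glued_conn (Y + Z) p v = glued_conn Y p v + glued_conn Z p v"
    using glued_conn_frame[OF fr _ v] Y Z VF_add[OF Y Z] YZ by metis
next
  fix f Y p v assume h: "smooth_fun A f" and Y: "Y \<in> VF" and v: "v \<in> T p"
  obtain E1 E2 U where fr: "frame E1 E2 U" "p \<in> U" using frame_at[of p] by blast
  note fV = frameD(1-3)[OF fr(1)]
  have e: "ip (\<lambda>q. f q *\<^sub>T Y q) E = (\<lambda>q. f q * ip Y E q)" if "E \<in> VF" for E
    using Y that by (simp add: fun_eq_iff g_scale_left vector_field_tangent)
  note d = dd_mult[OF h smooth_fun_g[OF Y fV(1)] v] dd_mult[OF h smooth_fun_g[OF Y fV(2)] v]
  have alg: "(a * x + m * y + a * y' * b) *\<^sub>T u + (a * x' + m * y' - a * y * b) *\<^sub>T w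
      = m *\<^sub>T (y *\<^sub>T u + y' *\<^sub>T w) + a *\<^sub>T ((x + y' * b) *\<^sub>T u + (x' - y * b) *\<^sub>T w)"
    for a b m x x' y y' and u w :: "'a tvec"
    by (rule ext) (simp add: tscale_def algebra_simps)
  have "frame_conn E1 E2 (\<lambda>q. f q *\<^sub>T Y q) p v
      = dd p v f *\<^sub>T (ip Y E1 p *\<^sub>T E1 p + ip Y E2 p *\<^sub>T E2 p) + f p *\<^sub>T frame_conn E1 E2 Y p v"
    unfolding frame_conn_def e[OF fV(1)] e[OF fV(2)] e[OF fV(1), THEN fun_cong]
      e[OF fV(2), THEN fun_cong] d by (rule alg)
  then show "glued_conn (\<lambda>q. f q *\<^sub>T Y q) p v = dd p v f *\<^sub>T Y p + f p *\<^sub>T glued_conn Y p v"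
    by (simp only: glued_conn_frame[OF fr VF_scale[OF h Y] v] glued_conn_frame[OF fr Y v]
        frame_expand[OF fr vector_field_tangent[OF Y], symmetric])
qed

text \<open>The glued connection shows that the SOME in \<open>levi_civita\<close> has something to
  choose. All later arguments about \<open>LC\<close> go through these three properties.\<close>

lemma levi_civita_props:
  "linear_connection A (levi_civita A \<gamma>)" "metric_connection A \<gamma> (levi_civita A \<gamma>)"
  "torsion_free A (levi_civita A \<gamma>)"
proof -
  have "metric_connection A \<gamma> glued_conn"
    unfolding metric_connection_def
  proof (intro ballI allI)
    fix Y Z p v assume h: "Y \<in> VF" "Z \<in> VF" "v \<in> T p"
    obtain E1 E2 U where fr: "frame E1 E2 U" "p \<in> U" using frame_at[of p] by blast
    show "dd p v (ip Y Z) = \<gamma> p (glued_conn Y p v) (Z p) + \<gamma> p (Y p) (glued_conn Z p v)"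
      unfolding glued_conn_frame[OF fr h(1,3)] glued_conn_frame[OF fr h(2,3)]
      by (rule frame_conn_metric[OF fr h(3,1,2)])
  qed
  moreover have "torsion_free A glued_conn"
    unfolding torsion_free_def
  proof (intro ballI ext)
    fix X Y p c assume h: "X \<in> VF" "Y \<in> VF"
    obtain E1 E2 U where fr: "frame E1 E2 U" "p \<in> U" using frame_at[of p] by blast
    have "cov glued_conn X Y p - cov glued_conn Y X p = lie X Y p"
      using glued_conn_frame[OF fr h(1) vector_field_tangent[OF h(2)]]
        glued_conn_frame[OF fr h(2) vector_field_tangent[OF h(1)]] frame_conn_torsion[OF fr h]
      by (simp add: cov_def)
    then show "(cov glued_conn X Y - cov glued_conn Y X) p c = lie X Y p c" by (metis minus_apply)
  qed
  ultimately have "\<exists>D. linear_connection A D \<and> metric_connection A \<gamma> D \<and> torsion_free A D"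
    using linear_connection_glued by blast
  from someI_ex[OF this] show "linear_connection A (levi_civita A \<gamma>)"
    "metric_connection A \<gamma> (levi_civita A \<gamma>)" "torsion_free A (levi_civita A \<gamma>)"
    unfolding levi_civita_def by blast+
qed

section \<open>Gauss curvature and divergence in a frame\<close>

abbreviation "LC \<equiv> levi_civita A \<gamma>"

text \<open>Gauss curvature and divergence are defined with the basis chosen at \<open>p\<close>. A
  frame through this very basis makes the frame formulas apply to them.\<close>

lemma some_orthonormal_basis_frame:
  obtains E1 E2 U where "frame E1 E2 U" "p \<in> U" "some_orthonormal_basis A \<gamma> p = (E1 p, E2 p)"
proof -
  obtain e1 e2 where e: "some_orthonormal_basis A \<gamma> p = (e1, e2)" by fastforce
  have "case_prod (orthonormal_basis A \<gamma> p) (some_orthonormal_basis A \<gamma> p)"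
    unfolding some_orthonormal_basis_def using orthonormal_basis_exists[of p]
    by (intro someI_ex[of "case_prod (orthonormal_basis A \<gamma> p)"]) auto
  then show ?thesis using frame_of_orthonormal_basis[of p e1 e2] that e by auto
qed

text \<open>\<open>curvature_at\<close> is a SOME over extensions of three vectors. By
  \<open>curvature_frame\<close> and \<open>ext_deriv_frame\<close> the component in question
  depends on the values of the extensions at \<open>p\<close> only, so every choice gives the same
  number.\<close>

lemma gauss_curvature_frame:
  assumes fr: "frame E1 E2 U" "p \<in> U" and b: "some_orthonormal_basis A \<gamma> p = (E1 p, E2 p)"
  shows "gauss_curvature A \<gamma> p = - ext_deriv (conn_form LC E1 E2) E1 E2 p"
proof -
  note fV = frameD(1-3)[OF fr(1)] and f = frameD(4-9)[OF fr(1), of p]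
  note L = levi_civita_props(1,2)
  have "\<gamma> p (curvature_at A LC p (E1 p) (E2 p) (E2 p)) (E1 p) = - ext_deriv (conn_form LC E1 E2) E1 E2 p"
    unfolding curvature_at_def
  proof (rule someI2_ex[where Q="\<lambda>z. \<gamma> p z (E1 p) = - ext_deriv (conn_form LC E1 E2) E1 E2 p"])
    show "\<exists>z. \<exists>X\<in>VF. \<exists>Y\<in>VF. \<exists>Z\<in>VF. X p = E1 p \<and> Y p = E2 p \<and> Z p = E2 p \<and> z = curvature A LC X Y Z p"
      using fV by blast
  next
    fix z assume "\<exists>X\<in>VF. \<exists>Y\<in>VF. \<exists>Z\<in>VF. X p = E1 p \<and> Y p = E2 p \<and> Z p = E2 p \<and> z = curvature A LC X Y Z p"
    then obtain X Y Z where z: "X \<in> VF" "Y \<in> VF" "Z \<in> VF" "X p = E1 p" "Y p = E2 p" "Z p = E2 p"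
      "z = curvature A LC X Y Z p" by blast
    show "\<gamma> p z (E1 p) = - ext_deriv (conn_form LC E1 E2) E1 E2 p"
      using curvature_frame(1)[OF L fr z(1-3)] ext_deriv_frame[OF one_form_conn_form[OF L(1) fV(1,2)] fr z(1,2)]
        f fr(2) by (simp add: z)
  qed
  then show ?thesis by (simp add: gauss_curvature_def b)
qed

text \<open>The form b of the overview: the determinant of the frame components of \<open>v\<close>
  and \<open>V\<close>, that is, the area form of the frame.\<close>

definition dual_form :: "'a vfield \<Rightarrow> 'a vfield \<Rightarrow> 'a vfield \<Rightarrow> 'a \<Rightarrow> 'a tvec \<Rightarrow> real" where
  "dual_form V E1 E2 = (\<lambda>p v. \<gamma> p v (E1 p) * ip V E2 p - \<gamma> p v (E2 p) * ip V E1 p)"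

lemma one_form_dual_form:
  assumes "V \<in> VF" "E1 \<in> VF" "E2 \<in> VF"
  shows "one_form (dual_form V E1 E2)"
  unfolding one_form_def
proof (intro conjI allI ballI)
  fix p u v a b assume "u \<in> T p" "v \<in> T p"
  then show "dual_form V E1 E2 p (a *\<^sub>T u + b *\<^sub>T v)
      = a * dual_form V E1 E2 p u + b * dual_form V E1 E2 p v"
    using assms by (simp add: dual_form_def g_lincomb vector_field_tangent) (simp add: algebra_simps)
next
  fix X assume "X \<in> VF"
  then show "smooth_fun A (\<lambda>p. dual_form V E1 E2 p (X p))"
    unfolding dual_form_def by (intro smooth_fun_diff smooth_fun_mult smooth_fun_g assms)
qed

text \<open>With b the dual form, b(E1) = <V,E2> and b(E2) = - <V,E1> on \<open>U\<close>, which
  yields the derivatives of the components of \<open>V\<close>. As torsion vanishes, [E1,E2] has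
  components - w(E1) and - w(E2), and b of it yields the connection terms of the divergence.\<close>

lemma divergence_frame:
  assumes fr: "frame E1 E2 U" "p \<in> U" and b: "some_orthonormal_basis A \<gamma> p = (E1 p, E2 p)"
    and V: "V \<in> VF"
  shows "divergence A \<gamma> V p = - ext_deriv (dual_form V E1 E2) E1 E2 p"
proof -
  note fV = frameD(1-3)[OF fr(1)] and f = frameD(4-9)[OF fr(1), of p]
  note L = levi_civita_props(1,2)
  define w where "w = conn_form LC E1 E2"
  note bas = conn_frame_basis[OF L fr, folded w_def]
  have "cov LC E1 E2 p - cov LC E2 E1 p = (cov LC E1 E2 - cov LC E2 E1) p" by simp
  also have "\<dots> = lie E1 E2 p"
    using levi_civita_props(3) fV unfolding torsion_free_def by simp
  finally have B: "lie E1 E2 p = LC E2 p (E1 p) - LC E1 p (E2 p)" by (simp add: cov_def)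
  have t: "LC E2 p (E1 p) \<in> T p" "LC E1 p (E2 p) \<in> T p"
    by (intro connD(1)[OF L(1)] fV f)+
  have B12: "\<gamma> p (lie E1 E2 p) (E1 p) = - w p (E1 p)" "\<gamma> p (lie E1 E2 p) (E2 p) = - w p (E2 p)"
    unfolding B using bas[OF f(1)] bas[OF f(2)] f t by (simp_all add: g_diff_left w_def conn_form_def)
  have "dd p (E1 p) (\<lambda>q. dual_form V E1 E2 q (E2 q)) = dd p (E1 p) (\<lambda>q. - ip V E1 q)"
    by (rule dd_local[OF _ _ f(1) fV(3) fr(2)])
      (use one_form_dual_form[OF V fV(1,2)] V fV frameD(7,9)[OF fr(1)] in
        \<open>auto simp: one_form_def dual_form_def intro: smooth_fun_minus smooth_fun_g\<close>)
  then have 1: "dd p (E1 p) (\<lambda>q. dual_form V E1 E2 q (E2 q)) = - dd p (E1 p) (ip V E1)"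
    using dd_minus[OF smooth_fun_g[OF V fV(1)] f(1)] by simp
  have 2: "dd p (E2 p) (\<lambda>q. dual_form V E1 E2 q (E1 q)) = dd p (E2 p) (ip V E2)"
    by (rule dd_local[OF _ _ f(2) fV(3) fr(2)])
      (use one_form_dual_form[OF V fV(1,2)] V fV frameD(6,8)[OF fr(1)] in
        \<open>auto simp: one_form_def dual_form_def intro: smooth_fun_g\<close>)
  have 3: "dual_form V E1 E2 p (lie E1 E2 p) = w p (E2 p) * ip V E1 p - w p (E1 p) * ip V E2 p"
    by (simp add: dual_form_def B12)
  show ?thesis
    using conn_frame(1)[OF L fr f(1) V] conn_frame(2)[OF L fr f(2) V]
    by (simp add: divergence_def b ext_deriv_def 1 2 3 flip: w_def)
qed

section \<open>Metric connections and vector fields\<close>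

text \<open>The added expression is a skew map applied to \<open>Y\<close>, written with inner
  products only and hence free of any orientation. It concerns one point and one vector there, so
  that \<open>V\<close> can be sought point by point.\<close>

definition differs_by :: "'a connection \<Rightarrow> 'a \<Rightarrow> 'a tvec \<Rightarrow> bool" where
  "differs_by D p V \<longleftrightarrow> (\<forall>Y\<in>VF. \<forall>v\<in>T p.
     D Y p v = LC Y p v - \<gamma> p v (Y p) *\<^sub>T V + \<gamma> p V (Y p) *\<^sub>T v)"

text \<open>At each point one number decides: the derivative of the connection form on the frame. By
  \<open>curvature_frame\<close> and \<open>ext_deriv_frame\<close> it controls the whole curvature
  there, and by \<open>ext\<close> it is the divergence minus the Gauss curvature if the frame
  passes through the chosen basis.\<close>

lemma flat_iff:
  assumes D: "linear_connection A D" "metric_connection A \<gamma> D" and V: "V \<in> VF"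
    and diff: "\<And>p. differs_by D p (V p)"
  shows "flat_connection A D \<longleftrightarrow> (\<forall>p. gauss_curvature A \<gamma> p = divergence A \<gamma> V p)"
proof -
  note L = levi_civita_props(1,2)
  have form: "conn_form D E1 E2 p v = conn_form LC E1 E2 p v - dual_form V E1 E2 p v"
    if fr: "frame E1 E2 U" and v: "v \<in> T p" for E1 E2 U p v
  proof -
    note fV = frameD(1-3)[OF fr] and f = frameD(4,5)[OF fr, of p]
    have "D E1 p v = LC E1 p v - \<gamma> p v (E1 p) *\<^sub>T V p + ip V E1 p *\<^sub>T v"
      using diff[of p] fV(1) v unfolding differs_by_def by blast
    then show ?thesis
      using v f V fV connD(1)[OF L(1) fV(1) v]
      by (simp add: conn_form_def dual_form_def g_add_left g_diff_left g_scale_left T_diff T_scale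
          vector_field_tangent)
  qed
  have ext: "ext_deriv (conn_form D E1 E2) E1 E2 p
      = ext_deriv (conn_form LC E1 E2) E1 E2 p - ext_deriv (dual_form V E1 E2) E1 E2 p"
    if fr: "frame E1 E2 U" for E1 E2 U p
  proof -
    note fV = frameD(1-3)[OF fr]
    have "ext_deriv (conn_form D E1 E2) E1 E2 p
        = ext_deriv (\<lambda>p v. conn_form LC E1 E2 p v - dual_form V E1 E2 p v) E1 E2 p"
      unfolding ext_deriv_def by (simp add: form[OF fr] vector_field_tangent fV lie_tangent)
    then show ?thesis
      using ext_deriv_diff[OF one_form_conn_form[OF L(1) fV(1,2)] one_form_dual_form[OF V fV(1,2)] fV(1,2)]
      by simp
  qed
  show ?thesis
  proof (intro iffI allI)
    fix p assume flat: "flat_connection A D"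
    obtain E1 E2 U where fr: "frame E1 E2 U" "p \<in> U" and b: "some_orthonormal_basis A \<gamma> p = (E1 p, E2 p)"
      by (rule some_orthonormal_basis_frame)
    note fV = frameD(1-3)[OF fr(1)] and f = frameD(4-9)[OF fr(1), of p]
    \<comment> \<open>The component of this curvature along \<open>E2\<close> is exactly the number
      in question.\<close>
    have "curvature A D E1 E2 E1 p = 0"
      using flat fV unfolding flat_connection_def by simp
    then have "ext_deriv (conn_form D E1 E2) E1 E2 p = 0"
      using curvature_frame(2)[OF D fr fV(1,2,1)] f fr(2) by (simp add: g_zero_left)
    then show "gauss_curvature A \<gamma> p = divergence A \<gamma> V p"
      using ext[OF fr(1)] by (simp add: gauss_curvature_frame[OF fr b] divergence_frame[OF fr b V])
  next
    assume eq: "\<forall>p. gauss_curvature A \<gamma> p = divergence A \<gamma> V p"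
    show "flat_connection A D"
      unfolding flat_connection_def
    proof (intro ballI)
      fix X Y Z assume X: "X \<in> VF" and Y: "Y \<in> VF" and Z: "Z \<in> VF"
      have "curvature A D X Y Z p = 0" for p
      proof -
        obtain E1 E2 U where fr: "frame E1 E2 U" "p \<in> U" and b: "some_orthonormal_basis A \<gamma> p = (E1 p, E2 p)"
          by (rule some_orthonormal_basis_frame)
        note fV = frameD(1-3)[OF fr(1)] and f = frameD(4-9)[OF fr(1), of p]
        have "ext_deriv (conn_form D E1 E2) E1 E2 p = 0"
          using eq[rule_format, of p] ext[OF fr(1)]
          by (simp add: gauss_curvature_frame[OF fr b] divergence_frame[OF fr b V])
        then have "ext_deriv (conn_form D E1 E2) X Y p = 0"
          using ext_deriv_frame[OF one_form_conn_form[OF D(1) fV(1,2)] fr X Y] by simp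
        then show ?thesis
          using curvature_frame[OF D fr X Y Z] f
          by (intro frame_eqI[OF fr curvature_tangent[OF D(1) X Y Z] T_zero]) (simp_all add: g_zero_left)
      qed
      then show "curvature A D X Y Z = 0" by (simp add: fun_eq_iff)
    qed
  qed
qed

text \<open>Paired with \<open>Z\<close>, the added term is skew in \<open>Y\<close> and
  \<open>Z\<close>, so it drops out of the metric rule. It is linear over functions in
  \<open>Y\<close>, so the Leibniz rule is inherited from \<open>LC\<close>.\<close>

lemma metric_connection_of_vector_field:
  assumes V: "V \<in> VF"
  shows "\<exists>D. linear_connection A D \<and> metric_connection A \<gamma> D \<and> (\<forall>p. differs_by D p (V p))"
proof -
  define D where "D = (\<lambda>Y p v. LC Y p v - \<gamma> p v (Y p) *\<^sub>T V p + \<gamma> p (V p) (Y p) *\<^sub>T v)"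
  note L = levi_civita_props(1,2)
  note t = connD(1)[OF L(1)] vector_field_tangent
  have "linear_connection A D"
    unfolding linear_connection_def
  proof (intro conjI ballI allI impI)
    fix Y p v assume h: "Y \<in> VF" "v \<in> T p"
    show "D Y p v \<in> T p"
      unfolding D_def by (intro T_add T_diff T_scale t(1)[OF h] vector_field_tangent[OF V] h(2))
  next
    fix X Y assume X: "X \<in> VF" and Y: "Y \<in> VF"
    have "(\<lambda>p. cov LC X Y p - ip X Y p *\<^sub>T V p + ip V Y p *\<^sub>T X p) \<in> VF"
      by (intro VF_add VF_diff VF_scale smooth_fun_g connD(2)[OF L(1)] V X Y)
    then show "cov D X Y \<in> VF" unfolding cov_def D_def .
  next
    fix Y p u v a b assume h: "Y \<in> VF" "u \<in> T p" "v \<in> T p"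
    show "D Y p (a *\<^sub>T u + b *\<^sub>T v) = a *\<^sub>T D Y p u + b *\<^sub>T D Y p v"
      unfolding D_def connD(3)[OF L(1) h] g_lincomb[OF h(2,3) vector_field_tangent[OF h(1)]]
      by (rule ext) (simp add: tscale_def algebra_simps)
  next
    fix Y Z p v assume h: "Y \<in> VF" "Z \<in> VF" "v \<in> T p"
    have e: "\<gamma> p u ((Y + Z) p) = \<gamma> p u (Y p) + \<gamma> p u (Z p)" if "u \<in> T p" for u
      using g_add_right[OF vector_field_tangent[OF h(1)] vector_field_tangent[OF h(2)] that] by simp
    show "D (Y + Z) p v = D Y p v + D Z p v"
      unfolding D_def connD(4)[OF L(1) h] e[OF h(3)] e[OF vector_field_tangent[OF V]]
      by (rule ext) (simp add: tscale_def algebra_simps)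
  next
    fix f Y p v assume h: "smooth_fun A f" "Y \<in> VF" "v \<in> T p"
    show "D (\<lambda>q. f q *\<^sub>T Y q) p v = dd p v f *\<^sub>T Y p + f p *\<^sub>T D Y p v"
      unfolding D_def connD(5)[OF L(1) h] g_scale_right[OF vector_field_tangent[OF h(2)] h(3)]
        g_scale_right[OF vector_field_tangent[OF h(2)] vector_field_tangent[OF V]]
      by (rule ext) (simp add: tscale_def algebra_simps)
  qed
  moreover have "metric_connection A \<gamma> D"
    unfolding metric_connection_def
  proof (intro ballI allI)
    fix Y Z p v assume h: "Y \<in> VF" "Z \<in> VF" "v \<in> T p"
    note s = vector_field_tangent[OF h(1), of p] vector_field_tangent[OF h(2), of p]
      vector_field_tangent[OF V, of p]
    show "dd p v (ip Y Z) = \<gamma> p (D Y p v) (Z p) + \<gamma> p (Y p) (D Z p v)"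
      unfolding metric_connD[OF L(2) h] D_def
      using h s t(1)[OF h(1,3)] t(1)[OF h(2,3)] g_sym[OF s(1) h(3)] g_sym[OF s(1) s(3)]
      by (simp add: g_simps T_add T_diff T_scale)
  qed
  moreover have "differs_by D p (V p)" for p
    by (simp add: differs_by_def D_def)
  ultimately show ?thesis by blast
qed

text \<open>\<open>W\<close> solves the equation that the connection form of \<open>D\<close> is
  that of \<open>LC\<close> minus b: its value on \<open>E2\<close> gives the component along
  \<open>E1\<close>, its value on \<open>E1\<close> the component along \<open>E2\<close>. For
  uniqueness it suffices to take the field and the direction both equal to \<open>E1\<close>, and
  then both equal to \<open>E2\<close>.\<close>

lemma differs_by_frame:
  assumes D: "linear_connection A D" "metric_connection A \<gamma> D" and fr: "frame E1 E2 U" "p \<in> U"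
  defines "W \<equiv> \<lambda>q. (conn_form D E1 E2 q (E2 q) - conn_form LC E1 E2 q (E2 q)) *\<^sub>T E1 q
      + (conn_form LC E1 E2 q (E1 q) - conn_form D E1 E2 q (E1 q)) *\<^sub>T E2 q"
  shows "W \<in> VF" "differs_by D p (W p)" "\<And>w. w \<in> T p \<Longrightarrow> differs_by D p w \<Longrightarrow> w = W p"
proof -
  note fV = frameD(1-3)[OF fr(1)] and f = frameD(4-9)[OF fr(1), of p]
  note L = levi_civita_props(1,2)
  note forms = one_form_conn_form[OF D(1) fV(1,2)] one_form_conn_form[OF L(1) fV(1,2)]
  note f' = f(3-6)[OF fr(2)]
  show W: "W \<in> VF"
    unfolding W_def using forms fV
    by (intro VF_add VF_scale smooth_fun_diff) (simp_all add: one_form_def)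
  note Wp = vector_field_tangent[OF W, of p]
  have W1: "\<gamma> p (W p) (E1 p) = conn_form D E1 E2 p (E2 p) - conn_form LC E1 E2 p (E2 p)"
    and W2: "\<gamma> p (W p) (E2 p) = conn_form LC E1 E2 p (E1 p) - conn_form D E1 E2 p (E1 p)"
    unfolding W_def using f(1,2) f' by (simp_all add: g_lincomb)
  show "differs_by D p (W p)"
    unfolding differs_by_def
  proof (intro ballI)
    fix Y v assume Y: "Y \<in> VF" and v: "v \<in> T p"
    note Yp = vector_field_tangent[OF Y, of p]
    note tt = connD(1)[OF D(1) Y v] connD(1)[OF L(1) Y v]
    note c = conn_frame[OF D fr v Y] conn_frame[OF L fr v Y]
    note o = one_form_frame[OF forms(1) fr v] one_form_frame[OF forms(2) fr v]
    note i = frame_inner[OF fr v Yp] frame_inner[OF fr Wp Yp]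
    have e: "\<gamma> p (LC Y p v - \<gamma> p v (Y p) *\<^sub>T W p + \<gamma> p (W p) (Y p) *\<^sub>T v) z
        = \<gamma> p (LC Y p v) z - \<gamma> p v (Y p) * \<gamma> p (W p) z + \<gamma> p (W p) (Y p) * \<gamma> p v z" if "z \<in> T p" for z
      using that tt v Wp by (simp add: g_add_left g_diff_left g_scale_left T_diff T_scale)
    show "D Y p v = LC Y p v - \<gamma> p v (Y p) *\<^sub>T W p + \<gamma> p (W p) (Y p) *\<^sub>T v"
    proof (rule frame_eqI[OF fr tt(1)])
      show "LC Y p v - \<gamma> p v (Y p) *\<^sub>T W p + \<gamma> p (W p) (Y p) *\<^sub>T v \<in> T p"
        by (intro T_add T_diff T_scale tt v Wp)
      show "\<gamma> p (D Y p v) (E1 p) = \<gamma> p (LC Y p v - \<gamma> p v (Y p) *\<^sub>T W p + \<gamma> p (W p) (Y p) *\<^sub>T v) (E1 p)"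
        by (subst e[OF f(1)]) (simp only: c o i W1 W2, simp add: algebra_simps)
      show "\<gamma> p (D Y p v) (E2 p) = \<gamma> p (LC Y p v - \<gamma> p v (Y p) *\<^sub>T W p + \<gamma> p (W p) (Y p) *\<^sub>T v) (E2 p)"
        by (subst e[OF f(2)]) (simp only: c o i W1 W2, simp add: algebra_simps)
    qed
  qed
  fix w assume w: "w \<in> T p" and d: "differs_by D p w"
  have d1: "D E1 p (E1 p) = LC E1 p (E1 p) - \<gamma> p (E1 p) (E1 p) *\<^sub>T w + \<gamma> p w (E1 p) *\<^sub>T E1 p"
    and d2: "D E2 p (E2 p) = LC E2 p (E2 p) - \<gamma> p (E2 p) (E2 p) *\<^sub>T w + \<gamma> p w (E2 p) *\<^sub>T E2 p"
    using d fV f(1,2) unfolding differs_by_def by blast+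
  note tL = connD(1)[OF L(1) fV(1) f(1)] connD(1)[OF L(1) fV(2) f(2)]
  have "\<gamma> p (D E1 p (E1 p)) (E2 p) = \<gamma> p (LC E1 p (E1 p)) (E2 p) - \<gamma> p w (E2 p)"
    unfolding d1 using f(1,2) f' w tL by (simp add: g_add_left g_diff_left g_scale_left T_diff T_scale)
  moreover have "\<gamma> p (D E2 p (E2 p)) (E1 p) = \<gamma> p (LC E2 p (E2 p)) (E1 p) - \<gamma> p w (E1 p)"
    unfolding d2 using f(1,2) f' w tL by (simp add: g_add_left g_diff_left g_scale_left T_diff T_scale)
  ultimately show "w = W p"
    using conn_frame_basis(3)[OF D fr f(2)] conn_frame_basis(3)[OF L fr f(2)]
    by (intro frame_eqI[OF fr w Wp]) (simp_all add: W1 W2, simp add: conn_form_def)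
qed

text \<open>The choice at each point refers to no frame, so no consistent orientation is required.
  Uniqueness identifies the chosen vectors near a point with the smooth field of
  \<open>differs_by_frame\<close>.\<close>

lemma vector_field_of_metric_connection:
  assumes D: "linear_connection A D" "metric_connection A \<gamma> D"
  shows "\<exists>V\<in>VF. \<forall>p. differs_by D p (V p)"
proof -
  define V where "V p = (SOME w. w \<in> T p \<and> differs_by D p w)" for p
  have V: "V p \<in> T p \<and> differs_by D p (V p)" for p
  proof -
    obtain E1 E2 U where fr: "frame E1 E2 U" "p \<in> U" using frame_at[of p] by blast
    have "\<exists>w. w \<in> T p \<and> differs_by D p w"
      by (intro exI conjI, rule vector_field_tangent[OF differs_by_frame(1)[OF D fr]])
        (rule differs_by_frame(2)[OF D fr])
    then show ?thesis unfolding V_def by (rule someI_ex)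
  qed
  have "V \<in> VF"
  proof (rule vector_field_localI)
    fix p
    obtain E1 E2 U where fr: "frame E1 E2 U" "p \<in> U" using frame_at[of p] by blast
    show "\<exists>U Y. open U \<and> p \<in> U \<and> Y \<in> VF \<and> (\<forall>q\<in>U. V q = Y q)"
      by (intro exI conjI ballI, rule frameD(3)[OF fr(1)], rule fr(2), rule differs_by_frame(1)[OF D fr],
          rule differs_by_frame(3)[OF D fr(1)]) (use V in blast)+
  qed
  then show ?thesis using V by blast
qed

end

theorem corollary1:
  fixes A :: "('a::{t2_space, second_countable_topology}) chart set"
    and \<gamma> :: "'a metric_tensor"
  assumes "riemannian_surface A \<gamma>"
  shows "(\<exists>D. linear_connection A D \<and> metric_connection A \<gamma> D \<and> flat_connection A D)
     \<longleftrightarrow> (\<exists>X\<in>vector_fields A. \<forall>p. gauss_curvature A \<gamma> p = divergence A \<gamma> X p)"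
proof -
  interpret riemannian_atlas A \<gamma>
    using assms by unfold_locales (auto simp: riemannian_surface_def smooth_surface_def)
  show ?thesis
  proof
    assume "\<exists>D. linear_connection A D \<and> metric_connection A \<gamma> D \<and> flat_connection A D"
    then obtain D where D: "linear_connection A D" "metric_connection A \<gamma> D" "flat_connection A D"
      by blast
    obtain V where V: "V \<in> VF" "\<forall>p. differs_by D p (V p)"
      using vector_field_of_metric_connection[OF D(1,2)] by blast
    then show "\<exists>X\<in>VF. \<forall>p. gauss_curvature A \<gamma> p = divergence A \<gamma> X p"
      using flat_iff[OF D(1,2) V(1)] D(3) by blast
  next
    assume "\<exists>X\<in>VF. \<forall>p. gauss_curvature A \<gamma> p = divergence A \<gamma> X p"
    then obtain V where V: "V \<in> VF" "\<forall>p. gauss_curvature A \<gamma> p = divergence A \<gamma> V p"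
      by blast
    obtain D where D: "linear_connection A D" "metric_connection A \<gamma> D" "\<forall>p. differs_by D p (V p)"
      using metric_connection_of_vector_field[OF V(1)] by blast
    then show "\<exists>D. linear_connection A D \<and> metric_connection A \<gamma> D \<and> flat_connection A D"
      using flat_iff[OF D(1,2) V(1)] V(2) by blast
  qed
qed

end
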